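(* Suppose that: $(X,Y),(X_1,Y_1),\dots,(X_n,Y_n)$ are i.i.d.; the prototypes $Z,Z_1,\dots,Z_m$ are i.i.d. with the same law as $X$ and independent of $(X,Y),(X_i,Y_i)_{i\le n}$; $g$ is $L$-Lipschitz on $S_X$; $\varepsilon=Y-g(X)$ is sub-Gaussian conditionally on $X$ and $Z$ with parameter $\sigma^2$; and the regularity assumption on $S_X$ and on the density $f_X$ given in the context holds, with constants $c_d,T_0,b,M$. Let $\delta\in(0,1/5)$ and $\psi_d=(18Md)^d(c_db)^{-d}$. If $n\ge1$ and $m\ge3$ are such that $$\frac nm\ge\frac{8\psi_d\log(1/\delta)}{\delta^d}\quad\text{and}\quad32\,d\log(12m/\delta)\le T_0^d\,m\,b\,c_d\,V_d,$$ then for all $x\in S_X$, with probability at least $1-5\delta$, $$|\hat g_{\mathrm{proto}}(x)-g(x)|\le\sqrt{\frac{4\sigma^2\psi_d\log(1/\delta)}{\delta^d}}\sqrt{\frac mn}+2L(\mathcal V(x))\left(\frac{32d\log(12m/\delta)}{m\,b\,c_d\,V_d}\right)^{1/d}.$$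
   Context: Setting: $d\ge1$; $(X,Y)$ is a random vector in $\mathbb R^d\times\mathbb R$, $X$ takes values in $S_X\subset\mathbb R^d$, $g(x)=\mathbb E[Y\mid X=x]$, $\varepsilon=Y-g(X)$. $\lambda$ is Lebesgue measure, $B(x,\tau)$ the Euclidean ball, $V_d$ the Lebesgue volume of the unit Euclidean ball in $\mathbb R^d$. Sub-Gaussian conditionally on $X$ and $Z$ with parameter $\sigma^2$: $\mathbb E[\varepsilon\mid X,Z]=0$ and $\mathbb E[\exp(t\varepsilon)\mid X,Z]\le\exp(t^2\sigma^2/2)$ a.s. for all $t\in\mathbb R$. Regularity assumption: there is $\rho_0>0$ with $S_X\subset B(0,\rho_0)$; there are $c_d>0$ and $T_0>0$ such that $\lambda(S_X\cap B(x,\tau))\ge c_d\lambda(B(x,\tau))$ for all $\tau\in(0,T_0]$ and $x\in S_X$, where (as can be arranged by changing $c_d$) $T_0=\rho_0$; and $X$ has a density $f_X$ on $S_X$ with $0<b\le f_X(x)\le M<\infty$ for $x\in S_X$. Proto-NN: for $x\in\mathbb R^d$ let $\hat X_1(x)$ be the nearest neighbor of $x$ (Euclidean norm) among $Z_1,\dots,Z_m$, ties broken in favor of larger indices. The Voronoi cells are $V_k=\{x\in S_X:\hat X_1(x)=Z_k\}$, $k=1,\dots,m$, and $\mathcal V(x)=V_k$ when $x\in V_k$. The estimator is $$\hat g_{\mathrm{proto}}(x)=\frac{\sum_{i=1}^nY_i\mathbf 1_{\mathcal V(x)}(X_i)}{\sum_{i=1}^n\mathbf 1_{\mathcal V(x)}(X_i)},\qquad0/0=0.$$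 For $V\subset S_X$, $L(V)$ is the smallest constant such that $|g(y)-g(z)|\le L(V)\|y-z\|_2$ for all $y,z\in V$. *)

theory Defs
  imports "HOL-Probability.Probability"
begin

section \<open>Probabilistic notions\<close>

definition iid_family ::
  "'w measure \<Rightarrow> 'b measure \<Rightarrow> ('i \<Rightarrow> 'w \<Rightarrow> 'b) \<Rightarrow> 'i set \<Rightarrow> bool" where
  "iid_family M N W I \<longleftrightarrow>
     prob_space.indep_vars M (\<lambda>_. N) W I \<and>
     (\<forall>i\<in>I. \<forall>j\<in>I. distr M N (W i) = distr M N (W j))"

text \<open>
  Independence of two random variables with values in different types (the
  library's \<open>indep_var\<close> requires a common codomain type).
\<close>

definition indep_rvs ::
  "'w measure \<Rightarrow> 'u measure \<Rightarrow> ('w \<Rightarrow> 'u) \<Rightarrow> 'v measure \<Rightarrow> ('w \<Rightarrow> 'v) \<Rightarrow> bool" where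
  "indep_rvs M N1 U1 N2 U2 \<longleftrightarrow>
     U1 \<in> measurable M N1 \<and> U2 \<in> measurable M N2 \<and>
     prob_space.indep_set M {U1 -` A \<inter> space M |A. A \<in> sets N1} {U2 -` A \<inter> space M |A. A \<in> sets N2}"

text \<open>
  The regression function \<open>g x = E[Y | X = x]\<close> is a measurable function on the set \<open>S\<close> where \<open>X\<close>
  takes its values such that \<open>g (X)\<close> is a version of the conditional expectation of \<open>Y\<close> given the
  sigma-algebra generated by \<open>X\<close>. Values of \<open>g\<close> outside \<open>S\<close> are irrelevant.
\<close>

definition regression_function ::
  "'w measure \<Rightarrow> ('w \<Rightarrow> 'a::euclidean_space) \<Rightarrow> ('w \<Rightarrow> real) \<Rightarrow> 'a set \<Rightarrow> ('a \<Rightarrow> real) \<Rightarrow> bool" where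
  "regression_function M X Y S g \<longleftrightarrow>
     integrable M Y \<and>
     g \<in> borel_measurable (restrict_space borel S) \<and>
     (AE \<omega> in M. real_cond_exp M (vimage_algebra (space M) X borel) Y \<omega> = g (X \<omega>))"

text \<open>
  Conditionally sub-Gaussian noise given a random variable \<open>U\<close>, with parameter \<open>v\<close> (a variance
  proxy). The exponential moment uses the nonnegative conditional expectation
  because \<^const>\<open>real_cond_exp\<close> would turn an infinite moment into \<open>0\<close>.
\<close>

definition cond_subgaussian ::
  "'w measure \<Rightarrow> ('w \<Rightarrow> 'u::topological_space) \<Rightarrow> real \<Rightarrow> ('w \<Rightarrow> real) \<Rightarrow> bool" where
  "cond_subgaussian M U v \<epsilon> \<longleftrightarrow>
     (let F = vimage_algebra (space M) U borel in
       integrable M \<epsilon> \<and>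
       (AE \<omega> in M. real_cond_exp M F \<epsilon> \<omega> = 0) \<and>
       (\<forall>t::real. AE \<omega> in M.
          nn_cond_exp M F (\<lambda>\<omega>. ennreal (exp (t * \<epsilon> \<omega>))) \<omega> \<le> ennreal (exp (t\<^sup>2 * v / 2))))"

text \<open>
  \<open>P\<close> holds with probability at least \<open>p\<close>: there is a measurable event of probability at least \<open>p\<close>
  on which \<open>P\<close> holds. If \<open>P\<close> is itself an event, this is the usual meaning (see below); the
  formulation is needed for conditions involving suprema over uncountable
  random sets, which need not be measurable unless the space is complete.
\<close>

definition with_prob_at_least :: "'w measure \<Rightarrow> real \<Rightarrow> ('w \<Rightarrow> bool) \<Rightarrow> bool" where
  "with_prob_at_least M p P \<longleftrightarrow>
     (\<exists>A\<in>sets M. p \<le> measure M A \<and> (\<forall>\<omega>\<in>A. P \<omega>))"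

lemma (in prob_space) with_prob_at_least_iff:
  assumes "{\<omega> \<in> space M. P \<omega>} \<in> events"
  shows "with_prob_at_least M p P \<longleftrightarrow> p \<le> prob {\<omega> \<in> space M. P \<omega>}"
proof
  assume "with_prob_at_least M p P"
  then obtain A where A: "A \<in> events" "p \<le> prob A" "\<forall>\<omega>\<in>A. P \<omega>"
    by (auto simp: with_prob_at_least_def)
  then have "A \<subseteq> {\<omega> \<in> space M. P \<omega>}"
    using sets.sets_into_space by blast
  then have "prob A \<le> prob {\<omega> \<in> space M. P \<omega>}"
    using assms by (rule finite_measure_mono)
  with A(2) show "p \<le> prob {\<omega> \<in> space M. P \<omega>}"
    by linarith
next
  assume "p \<le> prob {\<omega> \<in> space M. P \<omega>}"
  with assms show "with_prob_at_least M p P"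
    unfolding with_prob_at_least_def by (intro bexI[OF _ assms]) auto
qed


section \<open>Regularity of the covariate distribution\<close>

definition regular_support ::
  "'a::euclidean_space set \<Rightarrow> real \<Rightarrow> real \<Rightarrow> real \<Rightarrow> bool" where
  "regular_support S \<rho>0 c T0 \<longleftrightarrow>
     S \<in> sets borel \<and>
     0 < \<rho>0 \<and> S \<subseteq> cball 0 \<rho>0 \<and>
     0 < c \<and> 0 < T0 \<and> T0 = \<rho>0 \<and>
     (\<forall>\<tau> x. 0 < \<tau> \<and> \<tau> \<le> T0 \<and> x \<in> S \<longrightarrow>
        c * measure lborel (cball x \<tau>) \<le> measure lborel (S \<inter> cball x \<tau>))"

text \<open>\<open>f\<close> is the density of \<open>X\<close> on \<open>S\<close>; the density with respect to Lebesgue measure vanishes off \<open>S\<close>.\<close>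

definition bounded_density_on ::
  "'w measure \<Rightarrow> ('w \<Rightarrow> 'a::euclidean_space) \<Rightarrow> 'a set \<Rightarrow> ('a \<Rightarrow> real) \<Rightarrow> real \<Rightarrow> real \<Rightarrow> bool" where
  "bounded_density_on P X S f b M \<longleftrightarrow>
     distributed P lborel X (\<lambda>x. ennreal (f x * indicator S x)) \<and>
     0 < b \<and> (\<forall>x\<in>S. b \<le> f x \<and> f x \<le> M)"


section \<open>The prototype nearest neighbour estimator\<close>

text \<open>
  In a sample or prototype sequence, index \<open>0\<close> is reserved for the generic copy; the estimator
  only uses the data points \<open>1, \<dots>, n\<close> and the prototypes \<open>z 1, \<dots>, z m\<close>. The maximum breaks ties in
  favour of larger indices.
\<close>

definition nn_index :: "(nat \<Rightarrow> 'a::euclidean_space) \<Rightarrow> nat \<Rightarrow> 'a \<Rightarrow> nat" where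
  "nn_index z m x =
     Max {k \<in> {1..m}. \<forall>j\<in>{1..m}. norm (x - z k) \<le> norm (x - z j)}"

definition nearest :: "(nat \<Rightarrow> 'a::euclidean_space) \<Rightarrow> nat \<Rightarrow> 'a \<Rightarrow> 'a" where
  "nearest z m x = z (nn_index z m x)"

definition voronoi_cell ::
  "'a::euclidean_space set \<Rightarrow> (nat \<Rightarrow> 'a) \<Rightarrow> nat \<Rightarrow> nat \<Rightarrow> 'a set" where
  "voronoi_cell S z m k = {x \<in> S. nearest z m x = z k}"

definition voronoi_cell_at ::
  "'a::euclidean_space set \<Rightarrow> (nat \<Rightarrow> 'a) \<Rightarrow> nat \<Rightarrow> 'a \<Rightarrow> 'a set" where
  "voronoi_cell_at S z m x = voronoi_cell S z m (nn_index z m x)"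

text \<open>Coinciding prototypes have the same cell, so \<open>voronoi_cell_at\<close> is the cell containing \<open>x\<close>.\<close>

lemma voronoi_cell_at_eq:
  assumes "x \<in> voronoi_cell S z m k"
  shows "voronoi_cell_at S z m x = voronoi_cell S z m k"
  using assms by (auto simp: voronoi_cell_at_def voronoi_cell_def nearest_def)

lemma in_voronoi_cell_at: "x \<in> S \<Longrightarrow> x \<in> voronoi_cell_at S z m x"
  by (auto simp: voronoi_cell_at_def voronoi_cell_def nearest_def)

definition proto_nn ::
  "'a::euclidean_space set \<Rightarrow> (nat \<Rightarrow> 'a) \<Rightarrow> nat \<Rightarrow> (nat \<Rightarrow> 'a) \<Rightarrow> (nat \<Rightarrow> real) \<Rightarrow> nat \<Rightarrow> 'a \<Rightarrow> real" where
  "proto_nn S z m xs ys n x =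
     (\<Sum>i=1..n. ys i * indicator (voronoi_cell_at S z m x) (xs i)) /
     (\<Sum>i=1..n. indicator (voronoi_cell_at S z m x) (xs i))"

text \<open>The smallest nonnegative Lipschitz constant of \<open>g\<close> on \<open>V\<close>.\<close>

definition lip_const :: "('a::euclidean_space \<Rightarrow> real) \<Rightarrow> 'a set \<Rightarrow> real" where
  "lip_const g V = Inf {C. C-lipschitz_on V g}"

lemma lip_const_least:
  assumes "C-lipschitz_on V g"
  shows "(lip_const g V)-lipschitz_on V g" "lip_const g V \<le> C"
proof -
  let ?K = "{C. C-lipschitz_on V g}"
  have bdd: "bdd_below ?K"
    by (rule bdd_belowI[of _ 0]) (auto dest: lipschitz_on_nonneg)
  then show "lip_const g V \<le> C"
    unfolding lip_const_def using assms by (intro cInf_lower) auto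
  show "(lip_const g V)-lipschitz_on V g"
  proof (rule lipschitz_onI)
    show "0 \<le> lip_const g V"
      unfolding lip_const_def using assms
      by (intro cInf_greatest) (auto dest: lipschitz_on_nonneg)
    fix x y assume xy: "x \<in> V" "y \<in> V"
    show "dist (g x) (g y) \<le> lip_const g V * dist x y"
    proof (cases "x = y")
      case False
      have "dist (g x) (g y) / dist x y \<le> lip_const g V"
        unfolding lip_const_def
      proof (rule cInf_greatest)
        fix C assume "C \<in> ?K"
        then have "dist (g x) (g y) \<le> C * dist x y"
          using xy lipschitz_onD by blast
        with False show "dist (g x) (g y) / dist x y \<le> C"
          by (simp add: pos_divide_le_eq)
      qed (use assms in auto)
      with False show ?thesis by (simp add: pos_divide_le_eq)
    qed simp
  qed
qed

end

theory Submission
  imports Defs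
begin

text \<open>
  Let \<open>a = b c V\<^sub>d\<close>, so that the law \<open>\<mu>\<close> of \<open>X\<close> gives mass at least \<open>a t\<^sup>d\<close> to balls of radius
  \<open>t \<le> T\<^sub>0\<close> centred in \<open>S\<close>.

  Covering: put \<open>\<eta> = 1 / (2 d)\<close>. If some point of \<open>S\<close> has no prototype within distance \<open>\<tau>\<close>, then a
  set of \<open>\<mu>\<close>-measure at least \<open>a (\<eta> \<tau>)\<^sup>d\<close> has no prototype within \<open>(1 - \<eta>) \<tau>\<close>. The expected measure of
  the latter set is at most \<open>exp (- m a \<tau>\<^sup>d / 2)\<close>, so Markov's inequality replaces a union bound over a
  net. On the complementary event every cell has radius at most \<open>\<tau>\<close> around its prototype.

  Mass of the cell of \<open>x\<close>: if the two smallest distances from \<open>x\<close> to the prototypes differ by more than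
  \<open>s\<close>, the cell contains \<open>S \<inter> B(x, s / 2)\<close>. A gap of at most \<open>s\<close> means that for some \<open>j\<close> the distance \<open>R\<^sub>j\<close>
  lies in \<open>[T\<^sub>j, T\<^sub>j + s]\<close>, where \<open>T\<^sub>j\<close> is the minimum of the other distances. Since \<open>R\<^sub>j\<close> and \<open>T\<^sub>j\<close> are
  independent and a thin annulus of inner radius \<open>t\<close> has mass at most \<open>\<kappa> (1 + m \<mu>(B(x, t)))\<close>, this has
  probability at most \<open>\<kappa> (1 + m P(R\<^sub>j < T\<^sub>j))\<close>; the events \<open>R\<^sub>j < T\<^sub>j\<close> are disjoint, so the sum over \<open>j\<close>
  is at most \<open>2 \<kappa> m\<close>.

  Given the prototypes, the number of observations in the cell and the sum of the noise over the cell are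
  controlled by Chernoff bounds.
\<close>

section \<open>Deviation inequalities\<close>

context prob_space
begin

text \<open>Chernoff bound localised to the event \<open>A\<close>: the factor \<open>p\<close>
  stands for the weight of \<open>A\<close>, so that the bounds over the pieces of a partition can
  be added up later.\<close>

lemma subgaussian_tail_pos:
  assumes A: "A \<in> events" and W [measurable]: "W \<in> borel_measurable M"
    and mgf: "\<And>t. (\<integral>\<^sup>+\<omega>. ennreal (exp (t * W \<omega>)) * indicator A \<omega> \<partial>M) \<le> ennreal (exp (t\<^sup>2 * v / 2) * p)"
    and v: "0 < v" and l: "0 \<le> l" and p: "0 \<le> p"
  shows "prob {\<omega> \<in> A. sqrt (2 * v * l) \<le> W \<omega>} \<le> exp (- l) * p"
proof -
  note [measurable] = A
  define u where "u = sqrt (2 * v * l)"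
  \<comment> \<open>This \<open>t\<close> minimises \<open>t\<^sup>2 * v / 2 - t * u\<close>, and
    the minimum is \<open>- l\<close>.\<close>
  define t where "t = u / v"
  have u: "0 \<le> u" "u\<^sup>2 = 2 * v * l" using v l by (auto simp: u_def)
  have t: "0 \<le> t" "t * u = 2 * l" "t\<^sup>2 * v / 2 = l"
    using u v by (auto simp: t_def power_divide power2_eq_square field_simps)
  have sub: "A \<subseteq> space M" using A sets.sets_into_space by blast
  have "emeasure M {\<omega> \<in> A. u \<le> W \<omega>} \<le> emeasure M {\<omega> \<in> A. 1 \<le> ennreal (exp (- t * u)) * ennreal (exp (t * W \<omega>))}"
  proof (rule emeasure_mono)
    show "{\<omega> \<in> A. u \<le> W \<omega>} \<subseteq> {\<omega> \<in> A. 1 \<le> ennreal (exp (- t * u)) * ennreal (exp (t * W \<omega>))}"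
      using t mult_left_mono[of u _ t]
      by (auto simp: ennreal_mult[symmetric] exp_add[symmetric] simp del: ennreal_1 simp add: ennreal_1[symmetric])
    have "{\<omega> \<in> A. 1 \<le> ennreal (exp (- t * u)) * ennreal (exp (t * W \<omega>))} =
      A \<inter> {\<omega> \<in> space M. 1 \<le> ennreal (exp (- t * u)) * ennreal (exp (t * W \<omega>))}"
      using sub by auto
    also have "\<dots> \<in> events" by measurable
    finally show "{\<omega> \<in> A. 1 \<le> ennreal (exp (- t * u)) * ennreal (exp (t * W \<omega>))} \<in> events" .
  qed
  also have "\<dots> \<le> ennreal (exp (- t * u)) * (\<integral>\<^sup>+\<omega>. ennreal (exp (t * W \<omega>)) * indicator A \<omega> \<partial>M)"
    by (rule nn_integral_Markov_inequality) measurable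
  also have "\<dots> \<le> ennreal (exp (- t * u)) * ennreal (exp (t\<^sup>2 * v / 2) * p)"
    by (intro mult_left_mono mgf) simp
  also have "\<dots> = ennreal (exp (- l) * p)"
    using p t by (simp add: ennreal_mult[symmetric] exp_add[symmetric] mult.assoc[symmetric])
  finally show ?thesis
    using p by (simp add: u_def emeasure_eq_measure)
qed

text \<open>The strict inequality in the event makes the bound hold for \<open>v = 0\<close> as well.\<close>

lemma subgaussian_tail:
  assumes A: "A \<in> events" and W [measurable]: "W \<in> borel_measurable M"
    and mgf: "\<And>t. (\<integral>\<^sup>+\<omega>. ennreal (exp (t * W \<omega>)) * indicator A \<omega> \<partial>M) \<le> ennreal (exp (t\<^sup>2 * v / 2) * p)"
    and v: "0 \<le> v" and l: "0 < l" and p: "0 \<le> p"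
  shows "prob {\<omega> \<in> A. sqrt (2 * v * l) < W \<omega>} \<le> exp (- l) * p"
proof -
  note [measurable] = A
  have sub: "A \<subseteq> space M" using A sets.sets_into_space by blast
  \<comment> \<open>Raising the variance proxy by \<open>1 / Suc n\<close> makes it positive. The
    thresholds decrease to \<open>sqrt (2 * v * l)\<close>, so these events increase to the strict
    one, and continuity from below gives the bound.\<close>
  define B where "B = (\<lambda>n::nat. {\<omega> \<in> A. sqrt (2 * (v + 1 / Suc n) * l) \<le> W \<omega>})"
  have B: "prob (B n) \<le> exp (- l) * p" for n
    unfolding B_def
  proof (rule subgaussian_tail_pos[OF A W _ _ less_imp_le[OF l] p])
    fix t :: real
    have "exp (t\<^sup>2 * v / 2) * p \<le> exp (t\<^sup>2 * (v + 1 / Suc n) / 2) * p"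
      using p by (intro mult_right_mono) (auto intro!: divide_right_mono mult_left_mono)
    then show "(\<integral>\<^sup>+\<omega>. ennreal (exp (t * W \<omega>)) * indicator A \<omega> \<partial>M) \<le> ennreal (exp (t\<^sup>2 * (v + 1 / Suc n) / 2) * p)"
      by (intro order_trans[OF mgf] ennreal_leI)
  qed (use v in \<open>auto intro: add_nonneg_pos\<close>)
  have Bm: "B n \<in> events" for n
  proof -
    have "B n = A \<inter> {\<omega> \<in> space M. sqrt (2 * (v + 1 / Suc n) * l) \<le> W \<omega>}"
      using sub by (auto simp: B_def)
    also have "\<dots> \<in> events" by measurable
    finally show ?thesis .
  qed
  have inc: "incseq B"
  proof (rule incseq_SucI)
    fix n
    have "sqrt (2 * (v + 1 / Suc (Suc n)) * l) \<le> sqrt (2 * (v + 1 / Suc n) * l)"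
      using l by (intro real_sqrt_le_mono mult_right_mono mult_left_mono add_left_mono) (auto simp: field_simps)
    then show "B n \<subseteq> B (Suc n)" unfolding B_def by (blast intro: order_trans)
  qed
  have "(\<Union>n. B n) = {\<omega> \<in> A. sqrt (2 * v * l) < W \<omega>}"
  proof (intro set_eqI iffI)
    fix \<omega> assume "\<omega> \<in> (\<Union>n. B n)"
    then obtain n where n: "\<omega> \<in> A" "sqrt (2 * (v + 1 / Suc n) * l) \<le> W \<omega>" by (auto simp: B_def)
    have "sqrt (2 * v * l) < sqrt (2 * (v + 1 / Suc n) * l)"
      using l by (simp add: algebra_simps)
    from less_le_trans[OF this n(2)] n(1) show "\<omega> \<in> {\<omega> \<in> A. sqrt (2 * v * l) < W \<omega>}" by simp
  next
    fix \<omega> assume \<omega>: "\<omega> \<in> {\<omega> \<in> A. sqrt (2 * v * l) < W \<omega>}"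
    have "(\<lambda>n. sqrt (2 * (v + 1 / Suc n) * l)) \<longlonglongrightarrow> sqrt (2 * (v + 0) * l)"
      by (intro tendsto_intros LIMSEQ_Suc[OF lim_1_over_n])
    then have "\<forall>\<^sub>F n in sequentially. sqrt (2 * (v + 1 / Suc n) * l) < W \<omega>"
      using \<omega> by (intro order_tendstoD(2)) auto
    then obtain n where "sqrt (2 * (v + 1 / Suc n) * l) < W \<omega>"
      using eventually_happens by fastforce
    then show "\<omega> \<in> (\<Union>n. B n)" using \<omega> by (auto simp: B_def intro!: exI[of _ n])
  qed
  moreover have "(\<lambda>n. prob (B n)) \<longlonglongrightarrow> prob (\<Union>n. B n)"
    using Bm inc by (intro finite_Lim_measure_incseq) auto
  then have "prob (\<Union>n. B n) \<le> exp (- l) * p"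
    by (rule LIMSEQ_le_const2) (use B in auto)
  ultimately show ?thesis by simp
qed

text \<open>Chernoff's method with exponent \<open>- ln 2\<close>: each index contributes a factor 1
  - p / 2 \<le> \<open>exp (- (q / 2))\<close>, where p \<ge> \<open>q\<close> is the probability of
  falling into \<open>A\<close>.\<close>

lemma count_lower_tail:
  fixes W :: "'i \<Rightarrow> 'a \<Rightarrow> 'b::topological_space" and q :: real
  assumes ind: "indep_vars (\<lambda>_. borel) W I" and I: "finite I" and A [measurable]: "A \<in> sets borel"
    and q: "\<And>i. i \<in> I \<Longrightarrow> q \<le> prob {\<omega> \<in> space M. W i \<omega> \<in> A}" "0 \<le> q"
  shows "prob {\<omega> \<in> space M. (\<Sum>i\<in>I. indicator A (W i \<omega>)) < card I * q / 2} \<le> exp (- (card I * q / 8))"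
proof -
  have [measurable]: "W i \<in> borel_measurable M" if "i \<in> I" for i
    using ind that unfolding indep_vars_def by auto
  define N where "N \<omega> = (\<Sum>i\<in>I. indicator A (W i \<omega>) :: real)" for \<omega>
  have N [measurable]: "N \<in> borel_measurable M" unfolding N_def by measurable
  define h where "h i \<omega> = ennreal (exp (- ln 2 * indicator A (W i \<omega>)))" for i \<omega>
  have "indep_vars (\<lambda>_. borel) (\<lambda>i \<omega>. (\<lambda>x. ennreal (exp (- ln 2 * indicator A x))) (W i \<omega>)) I"
    by (rule indep_vars_compose2[OF ind]) measurable
  then have ih: "indep_vars (\<lambda>_. borel) h I" by (simp add: h_def[abs_def])
  have Eh: "(\<integral>\<^sup>+\<omega>. h i \<omega> \<partial>M) \<le> ennreal (exp (- (q / 2)))" if i: "i \<in> I" for i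
  proof -
    define E where "E = {\<omega> \<in> space M. W i \<omega> \<in> A}"
    have E [measurable]: "E \<in> events" unfolding E_def using i by measurable
    have "(\<integral>\<^sup>+\<omega>. h i \<omega> \<partial>M) = (\<integral>\<^sup>+\<omega>. ennreal (1 - indicator E \<omega> / 2) \<partial>M)"
      by (intro nn_integral_cong) (auto simp: h_def E_def exp_minus indicator_def)
    also have "\<dots> = ennreal (\<integral>\<omega>. 1 - indicator E \<omega> / 2 \<partial>M)"
      by (intro nn_integral_eq_integral) (auto intro!: integrable_const_bound[where B=1] split: split_indicator)
    also have "(\<integral>\<omega>. 1 - indicator E \<omega> / 2 \<partial>M) = 1 - prob E / 2"
      by (subst Bochner_Integration.integral_diff) (auto simp: prob_space emeasure_eq_measure)
    also have "\<dots> \<le> exp (- (q / 2))"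
      using q(1)[OF i] exp_ge_add_one_self[of "- (q / 2)"] by (simp add: E_def)
    finally show ?thesis by (simp add: ennreal_leI)
  qed
  have prodh: "(\<Prod>i\<in>I. h i \<omega>) = ennreal (exp (- ln 2 * N \<omega>))" for \<omega>
    using I by (simp add: h_def N_def prod_ennreal exp_sum[symmetric] sum_distrib_left)
  define b where "b = card I * q / 2"
  have b: "0 \<le> b" using q by (simp add: b_def)
  have "emeasure M {\<omega> \<in> space M. N \<omega> < b} \<le> emeasure M {\<omega> \<in> space M. 1 \<le> ennreal (exp (ln 2 * b)) * ennreal (exp (- ln 2 * N \<omega>))}"
    by (intro emeasure_mono)
      (auto simp: ennreal_mult[symmetric] exp_add[symmetric] simp del: ennreal_1 simp add: ennreal_1[symmetric])
  also have "\<dots> \<le> ennreal (exp (ln 2 * b)) * (\<integral>\<^sup>+\<omega>. ennreal (exp (- ln 2 * N \<omega>)) * indicator (space M) \<omega> \<partial>M)"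
    by (rule nn_integral_Markov_inequality) measurable
  also have "(\<integral>\<^sup>+\<omega>. ennreal (exp (- ln 2 * N \<omega>)) * indicator (space M) \<omega> \<partial>M) = (\<integral>\<^sup>+\<omega>. (\<Prod>i\<in>I. h i \<omega>) \<partial>M)"
    by (intro nn_integral_cong) (simp add: prodh)
  also have "\<dots> = (\<Prod>i\<in>I. \<integral>\<^sup>+\<omega>. h i \<omega> \<partial>M)"
    using I ih by (intro indep_vars_nn_integral) auto
  also have "ennreal (exp (ln 2 * b)) * \<dots> \<le> ennreal (exp (ln 2 * b)) * (\<Prod>i\<in>I. ennreal (exp (- (q / 2))))"
    using Eh by (intro mult_left_mono prod_mono_ennreal) auto
  also have "\<dots> = ennreal (exp (ln 2 * b - b))"
    by (simp add: prod_ennreal ennreal_power exp_of_nat_mult[symmetric] ennreal_mult[symmetric] exp_add[symmetric] b_def)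
  also have "\<dots> \<le> ennreal (exp (- (card I * q / 8)))"
  proof -
    \<comment> \<open>Since 25/36 < 3/4, at least a quarter of \<open>b\<close> survives in the
      exponent; as \<open>b\<close> is half of \<open>card I * q\<close>, this yields the constant
      8.\<close>
    have "ln 2 * b \<le> 3/4 * b" using b ln2_le_25_over_36 by (intro mult_right_mono) auto
    then have "ln 2 * b - b \<le> - (b / 4)" by linarith
    also have "\<dots> = - (card I * q / 8)" by (simp add: b_def)
    finally show ?thesis by (intro ennreal_leI) simp
  qed
  finally show ?thesis by (simp add: N_def b_def emeasure_eq_measure)
qed

text \<open>
  The number of summands is itself random; splitting according to the index set \<open>J\<close> of the
  observations that fall into \<open>A\<close> makes it deterministic, and the probabilities of the pieces sum to one.
\<close>

lemma self_normalized_tail: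
  fixes W :: "'i \<Rightarrow> 'a \<Rightarrow> 'b::topological_space"
  assumes ind: "indep_vars (\<lambda>_. borel) W I" and I: "finite I" and A [measurable]: "A \<in> sets borel"
    and e [measurable]: "e \<in> borel_measurable borel"
    and mgf: "\<And>i t. i \<in> I \<Longrightarrow> (\<integral>\<^sup>+\<omega>. ennreal (exp (t * e (W i \<omega>))) * indicator A (W i \<omega>) \<partial>M)
      \<le> ennreal (exp (t\<^sup>2 * v / 2) * prob {\<omega> \<in> space M. W i \<omega> \<in> A})"
    and v: "0 \<le> v" and l: "0 < l"
  shows "prob {\<omega> \<in> space M. sqrt (2 * v * l * (\<Sum>i\<in>I. indicator A (W i \<omega>))) < (\<Sum>i\<in>I. e (W i \<omega>) * indicator A (W i \<omega>))}
    \<le> exp (- l)"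
proof -
  have [measurable]: "W i \<in> borel_measurable M" if "i \<in> I" for i
    using ind that unfolding indep_vars_def by auto
  define p where "p i = prob {\<omega> \<in> space M. W i \<omega> \<in> A}" for i
  have p: "0 \<le> p i" "p i \<le> 1" for i by (auto simp: p_def)
  define E where "E J = {\<omega> \<in> space M. \<forall>i\<in>I. W i \<omega> \<in> A \<longleftrightarrow> i \<in> J}" for J
  have E [measurable]: "E J \<in> events" for J unfolding E_def using I by measurable
  \<comment> \<open>By independence this is the probability of \<open>E J\<close>.\<close>
  define P where "P J = (\<Prod>i\<in>J. p i) * (\<Prod>i\<in>I - J. 1 - p i)" for J
  have P: "0 \<le> P J" for J unfolding P_def using p by (intro mult_nonneg_nonneg prod_nonneg) auto
  have tail: "prob {\<omega> \<in> E J. sqrt (2 * (v * card J) * l) < (\<Sum>i\<in>J. e (W i \<omega>))} \<le> exp (- l) * P J"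
    if J: "J \<subseteq> I" for J
  proof (rule subgaussian_tail[OF E _ _ _ l P])
    have [measurable]: "W i \<in> borel_measurable M" if "i \<in> J" for i
      using J that by auto
    show "(\<lambda>\<omega>. \<Sum>i\<in>J. e (W i \<omega>)) \<in> borel_measurable M" by measurable
    show "0 \<le> v * card J" using v by simp
    fix t :: real
    \<comment> \<open>The factor of an index outside \<open>J\<close> is the indicator of the
      complement of \<open>A\<close>. The product over \<open>I\<close> is then the exponential of
      the sum over \<open>J\<close>, localised to \<open>E J\<close>, and its expectation
      factorises.\<close>
    define h where "h i x = (if i \<in> J then ennreal (exp (t * e x)) * indicator A x else indicator (- A) x)" for i x
    have h [measurable]: "h i \<in> borel_measurable borel" for i unfolding h_def by measurable
    have ih: "indep_vars (\<lambda>_. borel) (\<lambda>i \<omega>. h i (W i \<omega>)) I"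
      by (rule indep_vars_compose2[OF ind]) measurable
    have fJ: "finite J" using J I finite_subset by blast
    have "(\<integral>\<^sup>+\<omega>. ennreal (exp (t * (\<Sum>i\<in>J. e (W i \<omega>)))) * indicator (E J) \<omega> \<partial>M) =
      (\<integral>\<^sup>+\<omega>. (\<Prod>i\<in>I. h i (W i \<omega>)) \<partial>M)"
    proof (rule nn_integral_cong)
      fix \<omega> assume \<omega>: "\<omega> \<in> space M"
      show "ennreal (exp (t * (\<Sum>i\<in>J. e (W i \<omega>)))) * indicator (E J) \<omega> = (\<Prod>i\<in>I. h i (W i \<omega>))"
      proof (cases "\<omega> \<in> E J")
        case True
        have "(\<Prod>i\<in>I. h i (W i \<omega>)) = (\<Prod>i\<in>J. h i (W i \<omega>)) * (\<Prod>i\<in>I - J. h i (W i \<omega>))"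
          using I J by (simp add: prod.subset_diff mult.commute)
        also have "(\<Prod>i\<in>I - J. h i (W i \<omega>)) = 1"
          using True by (intro prod.neutral) (auto simp: h_def E_def)
        also have "(\<Prod>i\<in>J. h i (W i \<omega>)) = (\<Prod>i\<in>J. ennreal (exp (t * e (W i \<omega>))))"
          using True J by (intro prod.cong) (auto simp: h_def E_def)
        also have "\<dots> = ennreal (exp (t * (\<Sum>i\<in>J. e (W i \<omega>))))"
          using fJ by (simp add: prod_ennreal exp_sum sum_distrib_left)
        finally show ?thesis using True by simp
      next
        case False
        then obtain i where "i \<in> I" "\<not> (W i \<omega> \<in> A \<longleftrightarrow> i \<in> J)" using \<omega> by (auto simp: E_def)
        then have "i \<in> I" "h i (W i \<omega>) = 0" by (auto simp: h_def)
        then show ?thesis using I False by (auto intro!: prod_zero[symmetric])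
      qed
    qed
    also have "\<dots> = (\<Prod>i\<in>I. \<integral>\<^sup>+\<omega>. h i (W i \<omega>) \<partial>M)"
      using I ih by (intro indep_vars_nn_integral) auto
    also have "\<dots> \<le> (\<Prod>i\<in>I. ennreal (if i \<in> J then exp (t\<^sup>2 * v / 2) * p i else 1 - p i))"
    proof (rule prod_mono_ennreal)
      fix i assume i: "i \<in> I"
      show "(\<integral>\<^sup>+\<omega>. h i (W i \<omega>) \<partial>M) \<le> ennreal (if i \<in> J then exp (t\<^sup>2 * v / 2) * p i else 1 - p i)"
      proof (cases "i \<in> J")
        case True
        then show ?thesis using mgf[OF i, of t] by (simp add: h_def p_def)
      next
        case False
        have "(\<integral>\<^sup>+\<omega>. h i (W i \<omega>) \<partial>M) = (\<integral>\<^sup>+\<omega>. indicator (space M - {\<omega> \<in> space M. W i \<omega> \<in> A}) \<omega> \<partial>M)"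
          using False by (intro nn_integral_cong) (auto simp: h_def indicator_def)
        also have "\<dots> = ennreal (1 - p i)"
          using i by (simp add: emeasure_eq_measure p_def prob_compl)
        finally show ?thesis using False by simp
      qed
    qed
    also have "\<dots> = ennreal (\<Prod>i\<in>I. if i \<in> J then exp (t\<^sup>2 * v / 2) * p i else 1 - p i)"
      using p by (intro prod_ennreal) auto
    also have "(\<Prod>i\<in>I. if i \<in> J then exp (t\<^sup>2 * v / 2) * p i else 1 - p i) =
      (\<Prod>i\<in>J. exp (t\<^sup>2 * v / 2) * p i) * (\<Prod>i\<in>I - J. 1 - p i)"
      using I J by (subst prod.subset_diff[OF J I]) (simp add: mult.commute)
    also have "\<dots> = exp (t\<^sup>2 * (v * card J) / 2) * P J"
      by (simp add: P_def prod.distrib exp_of_nat_mult[symmetric] mult_ac)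
    finally show "(\<integral>\<^sup>+\<omega>. ennreal (exp (t * (\<Sum>i\<in>J. e (W i \<omega>)))) * indicator (E J) \<omega> \<partial>M)
      \<le> ennreal (exp (t\<^sup>2 * (v * card J) / 2) * P J)" .
  qed
  have meas: "{\<omega> \<in> E J. sqrt (2 * (v * card J) * l) < (\<Sum>i\<in>J. e (W i \<omega>))} \<in> events" if J: "J \<subseteq> I" for J
  proof -
    have [measurable]: "W i \<in> borel_measurable M" if "i \<in> J" for i
      using J that by auto
    have "{\<omega> \<in> E J. sqrt (2 * (v * card J) * l) < (\<Sum>i\<in>J. e (W i \<omega>))} =
      E J \<inter> {\<omega> \<in> space M. sqrt (2 * (v * card J) * l) < (\<Sum>i\<in>J. e (W i \<omega>))}"
      by (auto simp: E_def)
    also have "\<dots> \<in> events" by measurable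
    finally show ?thesis .
  qed
  have "prob {\<omega> \<in> space M. sqrt (2 * v * l * (\<Sum>i\<in>I. indicator A (W i \<omega>))) < (\<Sum>i\<in>I. e (W i \<omega>) * indicator A (W i \<omega>))}
    \<le> prob (\<Union>J\<in>Pow I. {\<omega> \<in> E J. sqrt (2 * (v * card J) * l) < (\<Sum>i\<in>J. e (W i \<omega>))})"
  proof (rule finite_measure_mono)
    show "(\<Union>J\<in>Pow I. {\<omega> \<in> E J. sqrt (2 * (v * card J) * l) < (\<Sum>i\<in>J. e (W i \<omega>))}) \<in> events"
      using I meas by (intro sets.finite_UN) auto
    show "{\<omega> \<in> space M. sqrt (2 * v * l * (\<Sum>i\<in>I. indicator A (W i \<omega>))) < (\<Sum>i\<in>I. e (W i \<omega>) * indicator A (W i \<omega>))}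
      \<subseteq> (\<Union>J\<in>Pow I. {\<omega> \<in> E J. sqrt (2 * (v * card J) * l) < (\<Sum>i\<in>J. e (W i \<omega>))})"
    proof
      fix \<omega> assume \<omega>: "\<omega> \<in> {\<omega> \<in> space M. sqrt (2 * v * l * (\<Sum>i\<in>I. indicator A (W i \<omega>))) < (\<Sum>i\<in>I. e (W i \<omega>) * indicator A (W i \<omega>))}"
      define J where "J = {i \<in> I. W i \<omega> \<in> A}"
      have "(\<Sum>i\<in>I. indicator A (W i \<omega>) :: real) = card J"
        using I by (simp add: J_def indicator_def sum.If_cases Int_def)
      moreover have "(\<Sum>i\<in>I. e (W i \<omega>) * indicator A (W i \<omega>)) = (\<Sum>i\<in>J. e (W i \<omega>))"
        unfolding J_def using I by (intro sum.mono_neutral_cong_right) (auto simp: indicator_def)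
      ultimately have "\<omega> \<in> {\<omega> \<in> E J. sqrt (2 * (v * card J) * l) < (\<Sum>i\<in>J. e (W i \<omega>))}"
        using \<omega> by (auto simp: E_def J_def mult_ac)
      then show "\<omega> \<in> (\<Union>J\<in>Pow I. {\<omega> \<in> E J. sqrt (2 * (v * card J) * l) < (\<Sum>i\<in>J. e (W i \<omega>))})"
        by (auto simp: J_def)
    qed
  qed
  also have "\<dots> \<le> (\<Sum>J\<in>Pow I. prob {\<omega> \<in> E J. sqrt (2 * (v * card J) * l) < (\<Sum>i\<in>J. e (W i \<omega>))})"
    using I meas by (intro finite_measure_subadditive_finite) auto
  also have "\<dots> \<le> (\<Sum>J\<in>Pow I. exp (- l) * P J)"
    using tail by (intro sum_mono) auto
  \<comment> \<open>Expanding the product over \<open>I\<close> gives the sum of \<open>P J\<close>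
    over all subsets \<open>J\<close>, and every factor is 1.\<close>
  also have "\<dots> = exp (- l) * (\<Prod>i\<in>I. p i + (1 - p i))"
    using I by (subst prod_add) (auto simp: P_def sum_distrib_left)
  finally show ?thesis by simp
qed

text \<open>Union bound over three events of probability at most \<open>exp (- l)\<close> each: too
  few observations in \<open>V\<close>, and a noise sum too large in one of the two directions. The
  set \<open>V\<close> is deterministic here; it becomes the random cell in
  \<open>cell_tail_joint\<close>.\<close>

lemma cell_tail:
  fixes X :: "'i \<Rightarrow> 'a \<Rightarrow> 'u::second_countable_topology" and Y :: "'i \<Rightarrow> 'a \<Rightarrow> real" and q v l :: real
  defines "N \<equiv> \<lambda>I V \<omega>. (\<Sum>i\<in>I. indicator V (X i \<omega>) :: real)"
  assumes ind: "indep_vars (\<lambda>_. borel) (\<lambda>i \<omega>. (X i \<omega>, Y i \<omega>)) I" and I: "finite I"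
    and V [measurable]: "V \<in> sets borel" and e [measurable]: "e \<in> borel_measurable borel"
    and mgf: "\<And>i t. i \<in> I \<Longrightarrow> (\<integral>\<^sup>+\<omega>. ennreal (exp (t * e (X i \<omega>, Y i \<omega>))) * indicator V (X i \<omega>) \<partial>M)
      \<le> ennreal (exp (t\<^sup>2 * v / 2) * prob {\<omega> \<in> space M. X i \<omega> \<in> V})"
    and q: "\<And>i. i \<in> I \<Longrightarrow> q \<le> prob {\<omega> \<in> space M. X i \<omega> \<in> V}" "0 \<le> q"
    and v: "0 \<le> v" and l: "0 < l" "l \<le> card I * q / 8"
  shows "prob {\<omega> \<in> space M. N I V \<omega> < card I * q / 2 \<or>
      sqrt (2 * v * l * N I V \<omega>) < \<bar>\<Sum>i\<in>I. e (X i \<omega>, Y i \<omega>) * indicator V (X i \<omega>)\<bar>} \<le> 3 * exp (- l)"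
proof -
  let ?W = "\<lambda>i \<omega>. (X i \<omega>, Y i \<omega>)"
  define A where "A = V \<times> (UNIV :: real set)"
  have A: "A \<in> sets borel" unfolding A_def by (intro borel_Times) auto
  have A_iff: "indicator A (?W i \<omega>) = (indicator V (X i \<omega>) :: 'c::zero_neq_one)" for i \<omega>
    by (auto simp: A_def indicator_def)
  have A_mem: "?W i \<omega> \<in> A \<longleftrightarrow> X i \<omega> \<in> V" for i \<omega> by (simp add: A_def)
  have W [measurable]: "?W i \<in> borel_measurable M" if "i \<in> I" for i
    using ind that unfolding indep_vars_def by auto
  have [measurable]: "X i \<in> borel_measurable M" if "i \<in> I" for i
    using measurable_compose[OF W[OF that] borel_measurable_continuous_onI[OF continuous_on_fst[OF continuous_on_id]]] by simp
  have [measurable]: "N I V \<in> borel_measurable M" unfolding N_def by measurable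
  define F where "F \<omega> = (\<Sum>i\<in>I. e (?W i \<omega>) * indicator V (X i \<omega>))" for \<omega>
  have [measurable]: "F \<in> borel_measurable M" unfolding F_def by measurable
  define B1 B2 B3 where "B1 = {\<omega> \<in> space M. N I V \<omega> < card I * q / 2}"
    and "B2 = {\<omega> \<in> space M. sqrt (2 * v * l * N I V \<omega>) < F \<omega>}"
    and "B3 = {\<omega> \<in> space M. sqrt (2 * v * l * N I V \<omega>) < - F \<omega>}"
  note B_defs = B1_def B2_def B3_def
  have "prob B1 \<le> exp (- (card I * q / 8))"
    using count_lower_tail[OF ind I A, of q] q by (simp add: A_iff A_mem B1_def N_def)
  also have "\<dots> \<le> exp (- l)" using l by simp
  finally have 1: "prob B1 \<le> exp (- l)" .
  have 2: "prob B2 \<le> exp (- l)"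
    using self_normalized_tail[OF ind I A e _ v l(1)] mgf by (simp add: A_iff A_mem B2_def N_def F_def)
  have "prob {\<omega> \<in> space M. sqrt (2 * v * l * (\<Sum>i\<in>I. indicator A (?W i \<omega>))) < (\<Sum>i\<in>I. - e (?W i \<omega>) * indicator A (?W i \<omega>))}
    \<le> exp (- l)"
  proof (rule self_normalized_tail[OF ind I A _ _ v l(1), of "\<lambda>w. - e w"])
    show "(\<integral>\<^sup>+\<omega>. ennreal (exp (t * - e (?W i \<omega>))) * indicator A (?W i \<omega>) \<partial>M)
      \<le> ennreal (exp (t\<^sup>2 * v / 2) * prob {\<omega> \<in> space M. ?W i \<omega> \<in> A})" if "i \<in> I" for i t
      using mgf[OF that, of "- t"] by (simp add: A_iff A_mem)
  qed measurable
  then have 3: "prob B3 \<le> exp (- l)"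
    by (simp add: A_iff B3_def N_def F_def sum_negf)
  have "{\<omega> \<in> space M. N I V \<omega> < card I * q / 2 \<or>
      sqrt (2 * v * l * N I V \<omega>) < \<bar>\<Sum>i\<in>I. e (?W i \<omega>) * indicator V (X i \<omega>)\<bar>} = B1 \<union> (B2 \<union> B3)"
    unfolding F_def[symmetric] B_defs by auto
  also have "prob \<dots> \<le> prob B1 + (prob B2 + prob B3)"
    by (intro order_trans[OF measure_Un_le] add_left_mono measure_Un_le)
      (auto simp: B_defs)
  finally show ?thesis using 1 2 3 by linarith
qed

end

text \<open>The indicator of \<open>A\<close> at \<open>U\<close> is measurable for the
  sigma-algebra of the pair, so the conditional bound may be integrated against it; afterwards
  \<open>V\<close> no longer appears.\<close>

lemma (in prob_space) cond_subgaussian_mgf: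
  fixes U :: "'a \<Rightarrow> 'u::second_countable_topology" and V :: "'a \<Rightarrow> 'v::second_countable_topology"
  assumes sub: "cond_subgaussian M (\<lambda>\<omega>. (U \<omega>, V \<omega>)) v e"
    and UV [measurable]: "U \<in> borel_measurable M" "V \<in> borel_measurable M"
    and A [measurable]: "A \<in> sets borel"
  shows "(\<integral>\<^sup>+\<omega>. ennreal (exp (t * e \<omega>)) * indicator A (U \<omega>) \<partial>M)
    \<le> ennreal (exp (t\<^sup>2 * v / 2) * prob {\<omega> \<in> space M. U \<omega> \<in> A})"
proof -
  define F where "F = vimage_algebra (space M) (\<lambda>\<omega>. (U \<omega>, V \<omega>)) (borel :: ('u \<times> 'v) measure)"
  have UV': "(\<lambda>\<omega>. (U \<omega>, V \<omega>)) \<in> borel_measurable M" by measurable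
  have F: "subalgebra M F"
    using measurable_sets[OF UV'] by (auto simp: subalgebra_def F_def sets_vimage_algebra2)
  interpret finite_measure_subalgebra M F by standard (rule F)
  have [measurable]: "e \<in> borel_measurable M"
    using sub by (auto simp: cond_subgaussian_def Let_def)
  have bound: "AE \<omega> in M. nn_cond_exp M F (\<lambda>\<omega>. ennreal (exp (t * e \<omega>))) \<omega> \<le> ennreal (exp (t\<^sup>2 * v / 2))"
    using sub by (auto simp: cond_subgaussian_def Let_def F_def)
  have "(\<lambda>\<omega>. (U \<omega>, V \<omega>)) \<in> F \<rightarrow>\<^sub>M borel"
    unfolding F_def by (rule measurable_vimage_algebra1) auto
  from measurable_compose[OF this borel_measurable_continuous_onI[OF continuous_on_fst[OF continuous_on_id]]]
  have UF [measurable]: "U \<in> borel_measurable F" by simp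
  have iF: "(\<lambda>\<omega>. indicator A (U \<omega>) :: ennreal) \<in> borel_measurable F" by measurable
  have "(\<integral>\<^sup>+\<omega>. ennreal (exp (t * e \<omega>)) * indicator A (U \<omega>) \<partial>M) =
    (\<integral>\<^sup>+\<omega>. indicator A (U \<omega>) * nn_cond_exp M F (\<lambda>\<omega>. ennreal (exp (t * e \<omega>))) \<omega> \<partial>M)"
    by (subst nn_cond_exp_intg[OF iF]) (auto simp: mult.commute)
  also have "\<dots> \<le> (\<integral>\<^sup>+\<omega>. ennreal (exp (t\<^sup>2 * v / 2)) * indicator {\<omega> \<in> space M. U \<omega> \<in> A} \<omega> \<partial>M)"
    using bound AE_space by (intro nn_integral_mono_AE, eventually_elim) (auto simp: indicator_def)
  also have "\<dots> = ennreal (exp (t\<^sup>2 * v / 2) * prob {\<omega> \<in> space M. U \<omega> \<in> A})"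
    by (subst nn_integral_cmult_indicator) (auto simp: emeasure_eq_measure ennreal_mult)
  finally show ?thesis .
qed

section \<open>Independence\<close>

text \<open>Fubini for the product law of the pair, integrating over \<open>U\<close> first. It is
  applied to one distance and the minimum of the others.\<close>

lemma (in prob_space) indep_var_emeasure:
  assumes ind: "indep_var borel U borel V"
    and Q': "Measurable.pred (borel \<Otimes>\<^sub>M borel) (\<lambda>x. Q (fst x) (snd x))"
  shows "emeasure M {\<omega> \<in> space M. Q (U \<omega>) (V \<omega>)} =
    (\<integral>\<^sup>+v. emeasure (distr M borel U) {u. Q u v} \<partial>distr M borel V)"
proof -
  have Q: "{(u, v). Q u v} \<in> sets (borel \<Otimes>\<^sub>M borel)"
    using Q' by (simp add: pred_def space_pair_measure case_prod_unfold)
  have [measurable]: "U \<in> borel_measurable M" "V \<in> borel_measurable M"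
    using ind by (auto dest: indep_var_rv1 indep_var_rv2)
  interpret U: prob_space "distr M borel U" by (rule prob_space_distr) simp
  interpret V: prob_space "distr M borel V" by (rule prob_space_distr) simp
  interpret UV: pair_prob_space "distr M borel U" "distr M borel V" ..
  have eq: "distr M borel U \<Otimes>\<^sub>M distr M borel V = distr M (borel \<Otimes>\<^sub>M borel) (\<lambda>x. (U x, V x))"
    using ind unfolding indep_var_distribution_eq by simp
  have "emeasure M {\<omega> \<in> space M. Q (U \<omega>) (V \<omega>)} =
    emeasure (distr M (borel \<Otimes>\<^sub>M borel) (\<lambda>x. (U x, V x))) {(u, v). Q u v}"
    using Q by (subst emeasure_distr) (auto intro!: arg_cong[where f="emeasure M"])
  also have "\<dots> = (\<integral>\<^sup>+v. emeasure (distr M borel U) ((\<lambda>u. (u, v)) -` {(u, v). Q u v}) \<partial>distr M borel V)"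
    unfolding eq[symmetric] by (rule UV.emeasure_pair_measure_alt2) (use Q in simp)
  finally show ?thesis by simp
qed

text \<open>A bound valid for every frozen value of \<open>U2\<close> survives averaging over
  \<open>U2\<close>, because independence makes the joint law a product. The prototypes take the
  place of \<open>U2\<close>, the data that of \<open>U1\<close>.\<close>

lemma indep_rvs_fubini_bound:
  assumes P: "prob_space P" and ind: "indep_rvs P N1 U1 N2 U2"
    and H: "H \<in> sets (N2 \<Otimes>\<^sub>M N1)"
    and bound: "\<And>z. z \<in> space N2 \<Longrightarrow> measure P {\<omega> \<in> space P. (z, U1 \<omega>) \<in> H} \<le> p" and p: "0 \<le> p"
  shows "measure P {\<omega> \<in> space P. (U2 \<omega>, U1 \<omega>) \<in> H} \<le> p"
proof -
  interpret P: prob_space P by fact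
  have U [measurable]: "U1 \<in> measurable P N1" "U2 \<in> measurable P N2"
    using ind by (auto simp: indep_rvs_def)
  interpret D1: prob_space "distr P N1 U1" by (rule P.prob_space_distr) simp
  interpret D2: prob_space "distr P N2 U2" by (rule P.prob_space_distr) simp
  interpret DD: pair_prob_space "distr P N2 U2" "distr P N1 U1" ..
  have joint: "distr P N2 U2 \<Otimes>\<^sub>M distr P N1 U1 = distr P (N2 \<Otimes>\<^sub>M N1) (\<lambda>\<omega>. (U2 \<omega>, U1 \<omega>))"
  proof (rule pair_measure_eqI)
    fix A B assume "A \<in> sets (distr P N2 U2)" "B \<in> sets (distr P N1 U1)"
    then have A: "A \<in> sets N2" and B: "B \<in> sets N1" by auto
    have *: "P.indep_set {U1 -` A \<inter> space P |A. A \<in> sets N1} {U2 -` A \<inter> space P |A. A \<in> sets N2}"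
      using ind by (simp add: indep_rvs_def)
    have "measure P ((U1 -` B \<inter> space P) \<inter> (U2 -` A \<inter> space P)) =
      measure P (U1 -` B \<inter> space P) * measure P (U2 -` A \<inter> space P)"
      by (rule P.indep_setD[OF *]) (use A B in auto)
    moreover have "(\<lambda>\<omega>. (U2 \<omega>, U1 \<omega>)) -` (A \<times> B) \<inter> space P = (U1 -` B \<inter> space P) \<inter> (U2 -` A \<inter> space P)"
      by auto
    ultimately show "emeasure (distr P N2 U2) A * emeasure (distr P N1 U1) B =
      emeasure (distr P (N2 \<Otimes>\<^sub>M N1) (\<lambda>\<omega>. (U2 \<omega>, U1 \<omega>))) (A \<times> B)"
      using A B by (simp add: emeasure_distr P.emeasure_eq_measure ennreal_mult[symmetric] mult.commute)
  qed (auto intro!: D1.sigma_finite_measure_axioms D2.sigma_finite_measure_axioms)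
  have "emeasure P {\<omega> \<in> space P. (U2 \<omega>, U1 \<omega>) \<in> H} = emeasure (distr P (N2 \<Otimes>\<^sub>M N1) (\<lambda>\<omega>. (U2 \<omega>, U1 \<omega>))) H"
    using H by (subst emeasure_distr) (auto intro!: arg_cong[where f="emeasure P"])
  also have "\<dots> = (\<integral>\<^sup>+z. emeasure (distr P N1 U1) (Pair z -` H) \<partial>distr P N2 U2)"
    unfolding joint[symmetric] by (rule D1.emeasure_pair_measure_alt) (use H in simp)
  also have "\<dots> \<le> (\<integral>\<^sup>+z. ennreal p \<partial>distr P N2 U2)"
  proof (rule nn_integral_mono)
    fix z assume "z \<in> space (distr P N2 U2)"
    then have z: "z \<in> space N2" by simp
    have "emeasure (distr P N1 U1) (Pair z -` H) = emeasure P {\<omega> \<in> space P. (z, U1 \<omega>) \<in> H}"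
      using H by (subst emeasure_distr) (auto intro!: arg_cong[where f="emeasure P"] sets_Pair1)
    then show "emeasure (distr P N1 U1) (Pair z -` H) \<le> ennreal p"
      using bound[OF z] by (simp add: P.emeasure_eq_measure ennreal_leI)
  qed
  also have "\<dots> = ennreal p" by (simp add: D2.emeasure_space_1[simplified])
  finally show ?thesis using p by (simp add: P.emeasure_eq_measure)
qed

section \<open>Covering and spacing of the prototypes\<close>

text \<open>Bernoulli's inequality for the power of \<open>t / (t + s)\<close>, multiplied by
  \<open>(t + s) ^ d\<close>.\<close>

lemma power_add_le_linear:
  fixes t s :: real
  assumes "0 \<le> t" "0 \<le> s"
  shows "(t + s) ^ d - t ^ d \<le> d * s * (t + s) ^ (d - 1)"
proof (cases "t + s = 0")
  case True
  with assms have "t = 0" "s = 0" by auto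
  then show ?thesis by simp
next
  case False
  then have pos: "t + s > 0" using assms by auto
  show ?thesis
  proof (cases d)
    case (Suc k)
    have "1 + real d * (- s / (t + s)) \<le> (1 + - s / (t + s)) ^ d"
      by (rule Bernoulli_inequality) (use pos assms in \<open>auto simp: field_simps\<close>)
    also have "1 + - s / (t + s) = t / (t + s)"
      using pos by (simp add: field_simps)
    finally have "(1 - d * s / (t + s)) * (t + s) ^ d \<le> t ^ d"
      using pos by (simp add: power_divide pos_le_divide_eq)
    moreover have "(1 - d * s / (t + s)) * (t + s) ^ d = (t + s) ^ d - d * s * (t + s) ^ (d - 1)"
      using pos Suc by (simp add: left_diff_distrib)
    ultimately show ?thesis by linarith
  qed simp
qed

text \<open>Bernoulli gives \<open>(1 - y) ^ n\<close> \<ge> 1/2, while the product of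
  \<open>(1 + y) ^ n\<close> and \<open>(1 - y) ^ n\<close> is at most 1.\<close>

lemma power_one_plus_le_two:
  fixes y :: real
  assumes "0 \<le> y" "2 * n * y \<le> 1"
  shows "(1 + y) ^ n \<le> 2"
proof (cases "n = 0")
  case False
  then have "1 * y \<le> real n * y" using assms by (intro mult_right_mono) auto
  then have y: "y \<le> 1/2" using assms by (auto simp: algebra_simps)
  have "1 + real n * (- y) \<le> (1 + - y) ^ n"
    by (rule Bernoulli_inequality) (use y in auto)
  then have "1/2 \<le> (1 - y) ^ n" using assms by (simp add: algebra_simps)
  then have "(1 + y) ^ n * (1/2) \<le> (1 + y) ^ n * (1 - y) ^ n"
    using assms by (intro mult_left_mono) auto
  also have "\<dots> = (1 - y\<^sup>2) ^ n"
    by (simp add: power_mult_distrib[symmetric] algebra_simps power2_eq_square)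
  also have "\<dots> \<le> 1"
    using y assms by (intro power_le_one) (auto simp: power2_eq_square intro: mult_le_one)
  finally show ?thesis by simp
qed simp

text \<open>These two mass bounds are how regularity and density enter covering and spacing. In the
  application \<open>a\<close> is b c V_d and \<open>K\<close> is M V_d. The annuli contain both
  bounding spheres, so that they match weak inequalities between distances.\<close>

locale ball_regular = prob_space \<mu> for \<mu> :: "'a::euclidean_space measure" +
  fixes S :: "'a set" and a K T0 :: real
  assumes sets_mu: "sets \<mu> = sets borel"
    and S_borel: "S \<in> sets borel"
    and full: "measure \<mu> S = 1"
    and a_pos: "0 < a" and T0_pos: "0 < T0"
    and lower: "\<And>x t. x \<in> S \<Longrightarrow> 0 \<le> t \<Longrightarrow> t \<le> T0 \<Longrightarrow> a * t ^ DIM('a) \<le> measure \<mu> (ball x t)"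
    and annulus: "\<And>x t s. 0 \<le> t \<Longrightarrow> 0 \<le> s \<Longrightarrow>
      measure \<mu> (cball x (t + s) - ball x t) \<le> K * ((t + s) ^ DIM('a) - t ^ DIM('a))"
begin

lemma K_nonneg: "0 \<le> K"
proof -
  have "0 \<le> K * ((0 + 1) ^ DIM('a) - 0 ^ DIM('a))"
    by (rule order_trans[OF measure_nonneg annulus]) auto
  then show ?thesis by (simp add: power_0_left)
qed

text \<open>At the scale \<open>r\<close> the mass bound \<open>a * r ^ d\<close>, multiplied by
  \<open>N\<close>, equals one. Up to that scale the annulus is controlled by its volume at radius
  \<open>r\<close>. For \<open>t > r\<close> the extra factor \<open>(t / r) ^ (d - 1)\<close> is at
  most \<open>(t / r) ^ d\<close>, which is \<open>N * a * t ^ d\<close> and hence at most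
  \<open>N\<close> times the mass of the inner ball.\<close>

lemma thin_annulus:
  fixes t s r N :: real
  assumes x: "x \<in> S" and t: "0 \<le> t" "t \<le> T0" and s: "0 \<le> s" "2 * DIM('a) * s \<le> r"
    and r: "0 < r" "N * a * r ^ DIM('a) = 1"
  shows "measure \<mu> (cball x (t + s) - ball x t) \<le>
    (2 * K * DIM('a) * s * r ^ (DIM('a) - 1)) * (1 + N * measure \<mu> (ball x t))"
proof -
  define d where "d = DIM('a)"
  \<comment> \<open>The radius \<open>u\<close> is never below \<open>r\<close>, so
    \<open>s / u\<close> is at most 1 / (2 d), and enlarging the radius by \<open>s\<close> costs at
    most a factor 2 in the power \<open>d - 1\<close>.\<close>
  define u where "u = max t r"
  have d: "d \<ge> 1" by (simp add: d_def Suc_leI)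
  have u: "0 < u" "t \<le> u" "r \<le> u" using r by (auto simp: u_def)
  have "2 * d * s \<le> u" using s u by (simp add: d_def)
  then have "2 * real (d - 1) * (s / u) \<le> 1"
    using u s d by (auto simp: field_simps of_nat_diff intro: order_trans[rotated])
  then have two: "(1 + s / u) ^ (d - 1) \<le> 2"
    using u s by (intro power_one_plus_le_two) auto
  have N: "N > 0" using r a_pos by (smt (verit) mult_nonneg_nonneg mult_nonpos_nonneg zero_less_power)
  have rd: "r ^ d = r * r ^ (d - 1)" using d by (cases d) auto
  have "(t + s) ^ (d - 1) \<le> (u * (1 + s / u)) ^ (d - 1)"
    using t s u by (intro power_mono) (auto simp: field_simps)
  also have "\<dots> \<le> u ^ (d - 1) * 2"
    unfolding power_mult_distrib using two u by (intro mult_left_mono) auto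
  also have "u ^ (d - 1) = r ^ (d - 1) * (u / r) ^ (d - 1)"
    using r by (simp add: power_divide)
  also have "(u / r) ^ (d - 1) \<le> (u / r) ^ d"
    using u r by (intro power_increasing) auto
  also have "(u / r) ^ d \<le> 1 + N * measure \<mu> (ball x t)"
  proof (cases "t \<le> r")
    case True
    then show ?thesis using r N by (simp add: u_def max_def)
  next
    case False
    have "(u / r) ^ d = N * (a * t ^ d)"
      using False r by (simp add: u_def power_divide d_def field_simps)
    also have "\<dots> \<le> N * measure \<mu> (ball x t)"
      using lower[OF x t] N by (intro mult_left_mono) (auto simp: d_def)
    finally show ?thesis by simp
  qed
  finally have *: "(t + s) ^ (d - 1) \<le> r ^ (d - 1) * (1 + N * measure \<mu> (ball x t)) * 2"
    using r by simp
  have "measure \<mu> (cball x (t + s) - ball x t) \<le> K * ((t + s) ^ d - t ^ d)"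
    unfolding d_def using t s by (intro annulus) auto
  also have "\<dots> \<le> K * (d * s * (t + s) ^ (d - 1))"
    using t s K_nonneg by (intro mult_left_mono power_add_le_linear) auto
  also have "\<dots> \<le> K * (d * s * (r ^ (d - 1) * (1 + N * measure \<mu> (ball x t)) * 2))"
    using * s K_nonneg by (intro mult_left_mono) auto
  finally show ?thesis by (simp add: d_def algebra_simps)
qed

text \<open>Comparing each distance with the minimum of the others, rather than with each of the
  others, avoids a sum over pairs of indices. Charging each annulus to the ball inside it keeps the
  bound linear in \<open>card I\<close> for given \<open>s\<close> and \<open>r\<close>.\<close>

lemma spacing:
  fixes Z :: "nat \<Rightarrow> 'w \<Rightarrow> 'a" and I :: "nat set"
    and s r :: real
  assumes P: "prob_space P" and ind: "prob_space.indep_vars P (\<lambda>_. borel) Z I"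
    and law: "\<And>k. k \<in> I \<Longrightarrow> distr P borel (Z k) = \<mu>"
    and I: "finite I" "2 \<le> card I"
    and x: "x \<in> S" and s: "0 \<le> s" "2 * DIM('a) * s \<le> r"
    and r: "0 < r" "card I * a * r ^ DIM('a) = 1"
  obtains B where "B \<in> sets P"
    "measure P B \<le> 4 * card I * (K * DIM('a) * s * r ^ (DIM('a) - 1))"
    "\<And>\<omega>. \<omega> \<in> space P - B \<Longrightarrow> \<exists>k\<in>I. dist x (Z k \<omega>) \<le> T0 \<Longrightarrow>
      \<exists>k\<in>I. \<forall>j\<in>I - {k}. dist x (Z k \<omega>) + s < dist x (Z j \<omega>)"
proof -
  define R where "R \<equiv> \<lambda>x k \<omega>. dist x (Z k \<omega>)"
  define T where "T \<equiv> \<lambda>x j \<omega>. Min ((\<lambda>k. R x k \<omega>) ` (I - {j}))"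
  \<comment> \<open>The index \<open>j\<close> is that of a second nearest prototype, so
    \<open>T x j\<close> is the smallest distance. The condition
    \<open>T x j \<omega> \<le> T0\<close> keeps the inner radius in the range of
    \<open>thin_annulus\<close>.\<close>
  define B where "B = {\<omega> \<in> space P. \<exists>j\<in>I. T x j \<omega> \<le> T0 \<and> T x j \<omega> \<le> R x j \<omega> \<and> R x j \<omega> \<le> T x j \<omega> + s}"
  interpret P: prob_space P by fact
  have [measurable]: "Z k \<in> borel_measurable P" if "k \<in> I" for k
    using ind that unfolding P.indep_vars_def by auto
  \<comment> \<open>Two indices are needed for \<open>T\<close> to be the minimum of a nonempty
    set.\<close>
  have I1: "I - {j} \<noteq> {}" for j
    using I card_mono[of "{j}" I] by fastforce
  define C where "C = 2 * K * DIM('a) * s * r ^ (DIM('a) - 1)"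
  have C: "0 \<le> C" using K_nonneg s r by (auto simp: C_def)
  have Rm [measurable]: "R x k \<in> borel_measurable P" if "k \<in> I" for k
    unfolding R_def using that by measurable
  have Tm [measurable]: "T x j \<in> borel_measurable P" for j
    unfolding T_def by (rule borel_measurable_Min) (use I in auto)
  have T0': "0 \<le> T x j \<omega>" for j \<omega>
    unfolding T_def using I I1 by (subst Min_ge_iff) (auto simp: R_def)
  have lawR: "emeasure (distr P borel (R x k)) A = emeasure \<mu> {z. dist x z \<in> A}"
    if "k \<in> I" "A \<in> sets borel" for k A
  proof -
    have "emeasure (distr P borel (R x k)) A = emeasure P (Z k -` {z. dist x z \<in> A} \<inter> space P)"
      using that by (subst emeasure_distr) (auto simp: R_def intro!: arg_cong[where f="emeasure P"])
    also have "\<dots> = emeasure (distr P borel (Z k)) {z. dist x z \<in> A}"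
    proof (subst emeasure_distr)
      have "(\<lambda>z. dist x z) -` A \<inter> space borel \<in> sets borel"
        using that by (intro measurable_sets[of _ borel borel]) auto
      then show "{z. dist x z \<in> A} \<in> sets borel" by (simp add: vimage_def)
    qed (use that in auto)
    finally show ?thesis using law that by simp
  qed
  \<comment> \<open>\<open>R x j\<close> and \<open>T x j\<close> are independent, so
    \<open>T x j\<close> may be frozen at \<open>t\<close>. The annulus of inner radius
    \<open>t\<close> is charged to the event \<open>R x j < t\<close>, and integration over
    \<open>t\<close> turns the charge into the probability of \<open>R x j < T x j\<close>.\<close>
  have one: "emeasure P {\<omega> \<in> space P. T x j \<omega> \<le> T0 \<and> T x j \<omega> \<le> R x j \<omega> \<and> R x j \<omega> \<le> T x j \<omega> + s}
    \<le> ennreal (C * (1 + card I * measure P {\<omega> \<in> space P. R x j \<omega> < T x j \<omega>}))" if j: "j \<in> I" for j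
  proof -
    have "P.indep_vars (\<lambda>_. borel) (\<lambda>k. dist x \<circ> Z k) I"
      by (rule P.indep_vars_compose[OF ind]) auto
    then have "P.indep_vars (\<lambda>_. borel) (R x) (insert j (I - {j}))"
      using j by (simp add: R_def comp_def insert_absorb)
    then have iv: "P.indep_var borel (R x j) borel (T x j)"
      unfolding T_def using I by (intro P.indep_vars_Min) auto
    have "emeasure P {\<omega> \<in> space P. T x j \<omega> \<le> T0 \<and> T x j \<omega> \<le> R x j \<omega> \<and> R x j \<omega> \<le> T x j \<omega> + s} =
      (\<integral>\<^sup>+t. emeasure (distr P borel (R x j)) {u. t \<le> T0 \<and> t \<le> u \<and> u \<le> t + s} \<partial>distr P borel (T x j))"
      by (rule P.indep_var_emeasure[OF iv, of "\<lambda>u t. t \<le> T0 \<and> t \<le> u \<and> u \<le> t + s"]) measurable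
    also have "\<dots> \<le> (\<integral>\<^sup>+t. ennreal C + ennreal (C * card I) * emeasure (distr P borel (R x j)) {u. u < t}
       \<partial>distr P borel (T x j))"
    proof (rule nn_integral_mono_AE)
      have "AE t in distr P borel (T x j). 0 \<le> t"
        by (subst AE_distr_iff) (auto simp: T0')
      then show "AE t in distr P borel (T x j).
         emeasure (distr P borel (R x j)) {u. t \<le> T0 \<and> t \<le> u \<and> u \<le> t + s} \<le>
         ennreal C + ennreal (C * card I) * emeasure (distr P borel (R x j)) {u. u < t}"
      proof eventually_elim
        fix t :: real assume t: "0 \<le> t"
        show "emeasure (distr P borel (R x j)) {u. t \<le> T0 \<and> t \<le> u \<and> u \<le> t + s} \<le>
         ennreal C + ennreal (C * card I) * emeasure (distr P borel (R x j)) {u. u < t}"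
        proof (cases "t \<le> T0")
          case True
          have "emeasure (distr P borel (R x j)) {u. t \<le> T0 \<and> t \<le> u \<and> u \<le> t + s} =
            emeasure \<mu> (cball x (t + s) - ball x t)"
            using True j by (subst lawR) (auto intro!: arg_cong[where f="emeasure \<mu>"])
          also have "\<dots> \<le> ennreal (C * (1 + card I * measure \<mu> (ball x t)))"
            unfolding C_def emeasure_eq_measure
            by (intro ennreal_leI thin_annulus x t True s r)
          also have "\<dots> = ennreal C + ennreal (C * card I) * emeasure \<mu> (ball x t)"
            using C by (simp add: emeasure_eq_measure ennreal_mult[symmetric] ennreal_plus[symmetric] algebra_simps del: ennreal_plus)
          also have "emeasure \<mu> (ball x t) = emeasure (distr P borel (R x j)) {u. u < t}"
            using j by (subst lawR) (auto intro!: arg_cong[where f="emeasure \<mu>"])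
          finally show ?thesis .
        qed simp
      qed
    qed
    also have "\<dots> = ennreal C * 1 + ennreal (C * card I) *
        (\<integral>\<^sup>+t. emeasure (distr P borel (R x j)) {u. u < t} \<partial>distr P borel (T x j))"
    proof (subst nn_integral_add)
      interpret D: prob_space "distr P borel (R x j)" using j by (intro P.prob_space_distr) simp
      interpret E: prob_space "distr P borel (T x j)" by (intro P.prob_space_distr) simp
      have "Measurable.pred (borel \<Otimes>\<^sub>M distr P borel (R x j)) (\<lambda>x :: real \<times> real. snd x < fst x)"
        by measurable
      then have "{(t, u). u < t} \<in> sets (borel \<Otimes>\<^sub>M distr P borel (R x j) :: (real \<times> real) measure)"
        by (simp add: pred_def space_pair_measure case_prod_unfold)
      from D.measurable_emeasure_Pair[OF this]
      have [measurable]: "(\<lambda>t. emeasure (distr P borel (R x j)) {u. u < t}) \<in> borel_measurable borel"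
        by simp
      show "(\<lambda>t. ennreal (C * card I) * emeasure (distr P borel (R x j)) {u. u < t}) \<in> borel_measurable (distr P borel (T x j))"
        by simp
      show "(\<integral>\<^sup>+t. ennreal C \<partial>distr P borel (T x j)) +
        (\<integral>\<^sup>+t. ennreal (C * card I) * emeasure (distr P borel (R x j)) {u. u < t} \<partial>distr P borel (T x j)) =
        ennreal C * 1 + ennreal (C * card I) * (\<integral>\<^sup>+t. emeasure (distr P borel (R x j)) {u. u < t} \<partial>distr P borel (T x j))"
        by (simp add: nn_integral_cmult E.emeasure_space_1[simplified])
    qed simp
    also have "(\<integral>\<^sup>+t. emeasure (distr P borel (R x j)) {u. u < t} \<partial>distr P borel (T x j)) =
       emeasure P {\<omega> \<in> space P. R x j \<omega> < T x j \<omega>}"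
      by (rule P.indep_var_emeasure[OF iv, of "\<lambda>u t. u < t", symmetric]) measurable
    finally show ?thesis
      using C by (simp add: P.emeasure_eq_measure ennreal_mult[symmetric] ennreal_plus[symmetric] algebra_simps del: ennreal_plus)
  qed
  \<comment> \<open>At most one index can be strictly nearer to \<open>x\<close> than all the
    others.\<close>
  have first: "(\<Sum>j\<in>I. measure P {\<omega> \<in> space P. R x j \<omega> < T x j \<omega>}) \<le> 1"
  proof -
    have "disjoint_family_on (\<lambda>j. {\<omega> \<in> space P. R x j \<omega> < T x j \<omega>}) I"
    proof (auto simp: disjoint_family_on_def)
      fix j k \<omega> assume *: "j \<in> I" "k \<in> I" "j \<noteq> k" "R x j \<omega> < T x j \<omega>" "R x k \<omega> < T x k \<omega>"
      have "T x j \<omega> \<le> R x k \<omega>" "T x k \<omega> \<le> R x j \<omega>"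
        unfolding T_def using * I by (auto intro!: Min_le)
      with * show False by linarith
    qed
    then have "(\<Sum>j\<in>I. measure P {\<omega> \<in> space P. R x j \<omega> < T x j \<omega>}) =
      measure P (\<Union>j\<in>I. {\<omega> \<in> space P. R x j \<omega> < T x j \<omega>})"
      using I by (intro P.finite_measure_finite_Union[symmetric]) auto
    then show ?thesis by simp
  qed
  have "measure P B = measure P (\<Union>j\<in>I. {\<omega> \<in> space P. T x j \<omega> \<le> T0 \<and> T x j \<omega> \<le> R x j \<omega> \<and> R x j \<omega> \<le> T x j \<omega> + s})"
    by (rule arg_cong[where f="measure P"]) (auto simp: B_def)
  also have "\<dots> \<le> (\<Sum>j\<in>I. measure P {\<omega> \<in> space P. T x j \<omega> \<le> T0 \<and> T x j \<omega> \<le> R x j \<omega> \<and> R x j \<omega> \<le> T x j \<omega> + s})"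
    using I by (intro P.finite_measure_subadditive_finite) auto
  also have "\<dots> \<le> (\<Sum>j\<in>I. C * (1 + card I * measure P {\<omega> \<in> space P. R x j \<omega> < T x j \<omega>}))"
    using one C by (intro sum_mono) (simp add: P.emeasure_eq_measure)
  also have "\<dots> = C * (card I + card I * (\<Sum>j\<in>I. measure P {\<omega> \<in> space P. R x j \<omega> < T x j \<omega>}))"
    by (simp add: sum_distrib_left sum.distrib algebra_simps)
  \<comment> \<open>One share of \<open>card I\<close> comes from the constant summands, the other
    from the disjoint events; \<open>C\<close> itself carries a factor 2, whence the 4.\<close>
  also have "\<dots> \<le> C * (card I + card I * 1)"
    using first C by (intro mult_left_mono add_left_mono) (auto intro!: mult_left_le)
  finally have "measure P B \<le> 4 * card I * (K * DIM('a) * s * r ^ (DIM('a) - 1))"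
    by (simp add: C_def algebra_simps)
  moreover have "B \<in> sets P" unfolding B_def using I by measurable
  moreover have "\<exists>k\<in>I. \<forall>j\<in>I - {k}. dist x (Z k \<omega>) + s < dist x (Z j \<omega>)"
    if \<omega>: "\<omega> \<in> space P - B" and near: "\<exists>k\<in>I. dist x (Z k \<omega>) \<le> T0" for \<omega>
  proof -
    have ne: "I \<noteq> {}" using near by auto
    define k where "k = arg_min_on (\<lambda>k. R x k \<omega>) I"
    have k: "k \<in> I" unfolding k_def using I(1) ne by (rule arg_min_if_finite)
    have kmin: "R x k \<omega> \<le> R x j \<omega>" if "j \<in> I" for j
      unfolding k_def using I(1) ne that by (rule arg_min_least)
    have "R x k \<omega> + s < R x j \<omega>" if j: "j \<in> I - {k}" for j
    proof (rule ccontr)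
      assume "\<not> R x k \<omega> + s < R x j \<omega>"
      \<comment> \<open>Removing \<open>j\<close> leaves the overall minimiser \<open>k\<close> in
        place, so a failing gap at \<open>j\<close> puts the outcome into \<open>B\<close> with this
        very \<open>j\<close>.\<close>
      moreover have "T x j \<omega> = R x k \<omega>"
        unfolding T_def using I k kmin j by (intro Min_eqI) auto
      moreover have "R x k \<omega> \<le> T0" using near kmin by (force simp: R_def)
      ultimately have "\<omega> \<in> B" using kmin[of j] j \<omega> by (auto simp: B_def intro!: bexI[of _ j])
      then show False using \<omega> by simp
    qed
    then show ?thesis using k by (auto simp: R_def)
  qed
  ultimately show thesis using that by blast
qed

text \<open>The prefactor is the reciprocal of the mass threshold in Markov's inequality; the
  exponent loses a factor 2 because the tested radius is slightly smaller than \<tau>.\<close>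

lemma covering:
  fixes Z :: "nat \<Rightarrow> 'w \<Rightarrow> 'a" and I :: "nat set" and \<tau> :: real
  assumes P: "prob_space P" and ind: "prob_space.indep_vars P (\<lambda>_. borel) Z I"
    and law: "\<And>k. k \<in> I \<Longrightarrow> distr P borel (Z k) = \<mu>"
    and I: "finite I" "I \<noteq> {}"
    and \<tau>: "0 < \<tau>" "\<tau> \<le> T0"
  obtains B where "B \<in> sets P"
    "measure P B \<le> (2 * DIM('a)) ^ DIM('a) / (a * \<tau> ^ DIM('a)) * exp (- (card I * a * \<tau> ^ DIM('a) / 2))"
    "\<And>\<omega> y. \<omega> \<in> space P - B \<Longrightarrow> y \<in> S \<Longrightarrow> \<exists>k\<in>I. dist y (Z k \<omega>) \<le> \<tau>"
proof -
  interpret P: prob_space P by fact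
  interpret PM: pair_prob_space P \<mu> ..
  have [measurable]: "Z k \<in> borel_measurable P" if "k \<in> I" for k
    using ind that unfolding P.indep_vars_def by auto
  note [measurable_cong] = sets_mu
  note [measurable] = S_borel
  have space_mu [simp]: "space \<mu> = UNIV" using sets_eq_imp_space_eq[OF sets_mu] by simp
  define d where "d = DIM('a)"
  have d: "d \<ge> 1" by (simp add: d_def Suc_leI)
  \<comment> \<open>By Bernoulli \<open>(1 - \<eta>) ^ d\<close> is at least
    \<open>1 - d * \<eta>\<close>, which is 1/2 for this choice.\<close>
  define \<eta> where "\<eta> = 1 / (2 * real d)"
  have \<eta>: "0 < \<eta>" "\<eta> < 1" using d by (auto simp: \<eta>_def)
  have half: "1/2 \<le> (1 - \<eta>) ^ d"
    using Bernoulli_inequality[of "- \<eta>" d] \<eta> d by (simp add: \<eta>_def)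
  define thr where "thr = a * (\<eta> * \<tau>) ^ d"
  have thr: "thr > 0" using a_pos \<eta> \<tau> by (simp add: thr_def)
  define e where "e = exp (- (card I * a * \<tau> ^ d / 2))"
  \<comment> \<open>The slice of \<open>Q\<close> at an outcome is the exposed part of
    \<open>S\<close>, whose mass is called \<open>v\<close> below. The slice at a point of
    \<open>S\<close> is an intersection of independent events, one for each prototype. Fubini trades
    the one for the other.\<close>
  define Q where "Q = {x \<in> space (P \<Otimes>\<^sub>M \<mu>). snd x \<in> S \<and> (\<forall>k\<in>I. (1 - \<eta>) * \<tau> < dist (snd x) (Z k (fst x)))}"
  have Q: "Q \<in> sets (P \<Otimes>\<^sub>M \<mu>)"
    unfolding Q_def using I by measurable
  define v where "v = (\<lambda>\<omega>. emeasure \<mu> (Pair \<omega> -` Q))"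
  have v [measurable]: "v \<in> borel_measurable P"
    unfolding v_def by (rule measurable_emeasure_Pair[OF Q])
  have slice: "emeasure P ((\<lambda>\<omega>. (\<omega>, y)) -` Q) \<le> ennreal e" if y: "y \<in> S" for y
  proof -
    define A where "A = - cball y ((1 - \<eta>) * \<tau>)"
    have A [measurable]: "A \<in> sets borel" by (auto simp: A_def)
    have pA: "measure P (Z k -` A \<inter> space P) \<le> exp (- (a * \<tau> ^ d / 2))" if "k \<in> I" for k
    proof -
      have "measure P (Z k -` A \<inter> space P) = measure (distr P borel (Z k)) A"
        using that by (subst measure_distr) auto
      also have "\<dots> = measure \<mu> (space \<mu> - cball y ((1 - \<eta>) * \<tau>))"
        using law[OF that] by (simp add: A_def Compl_eq_Diff_UNIV)
      also have "\<dots> = 1 - measure \<mu> (cball y ((1 - \<eta>) * \<tau>))"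
        by (rule prob_compl) (simp add: sets_mu)
      also have "\<dots> \<le> 1 - measure \<mu> (ball y ((1 - \<eta>) * \<tau>))"
        by (intro diff_left_mono finite_measure_mono) (auto simp: sets_mu)
      also have "\<dots> \<le> 1 - a * ((1 - \<eta>) * \<tau>) ^ d"
        unfolding d_def using y \<eta> \<tau> by (intro diff_left_mono lower) (auto simp: mult_le_one intro: order_trans[OF mult_left_le_one_le])
      also have "\<dots> \<le> 1 - a * \<tau> ^ d / 2"
        using half mult_left_mono[of "1/2" "(1 - \<eta>) ^ d" "a * \<tau> ^ d"] a_pos \<tau>
        unfolding power_mult_distrib by (simp add: mult_ac)
      also have "\<dots> \<le> exp (- (a * \<tau> ^ d / 2))"
        using exp_ge_add_one_self[of "- (a * \<tau> ^ d / 2)"] by simp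
      finally show ?thesis .
    qed
    have "(\<lambda>\<omega>. (\<omega>, y)) -` Q = (\<Inter>k\<in>I. Z k -` A \<inter> space P)"
      using I y by (auto simp: Q_def A_def space_pair_measure not_le)
    also have "measure P \<dots> = (\<Prod>k\<in>I. measure P (Z k -` A \<inter> space P))"
      using I by (intro P.indep_varsD[OF ind]) auto
    also have "\<dots> \<le> (\<Prod>k\<in>I. exp (- (a * \<tau> ^ d / 2)))"
      using pA by (intro prod_mono) auto
    also have "\<dots> = e"
      by (simp add: e_def exp_of_nat_mult[symmetric] mult.assoc)
    finally show ?thesis by (simp add: P.emeasure_eq_measure ennreal_leI)
  qed
  have "(\<integral>\<^sup>+\<omega>. v \<omega> \<partial>P) = (\<integral>\<^sup>+y. emeasure P ((\<lambda>\<omega>. (\<omega>, y)) -` Q) \<partial>\<mu>)"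
    unfolding v_def
    by (simp add: emeasure_pair_measure_alt[OF Q, symmetric] PM.emeasure_pair_measure_alt2[OF Q])
  also have "\<dots> \<le> (\<integral>\<^sup>+y. ennreal e \<partial>\<mu>)"
  proof (rule nn_integral_mono)
    fix y
    show "emeasure P ((\<lambda>\<omega>. (\<omega>, y)) -` Q) \<le> ennreal e"
    proof (cases "y \<in> S")
      case False
      then have "(\<lambda>\<omega>. (\<omega>, y)) -` Q = {}" by (auto simp: Q_def)
      then show ?thesis by simp
    qed (rule slice)
  qed
  also have "\<dots> = ennreal e" by (simp add: emeasure_space_1[simplified])
  finally have int: "(\<integral>\<^sup>+\<omega>. v \<omega> \<partial>P) \<le> ennreal e" .
  define B where "B = {\<omega> \<in> space P. 1 \<le> ennreal (1 / thr) * v \<omega>}"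
  have "emeasure P B \<le> ennreal (1 / thr) * (\<integral>\<^sup>+\<omega>. v \<omega> * indicator (space P) \<omega> \<partial>P)"
    using nn_integral_Markov_inequality[of "v" "space P" P "ennreal (1 / thr)"]
    by (simp add: B_def)
  also have "(\<integral>\<^sup>+\<omega>. v \<omega> * indicator (space P) \<omega> \<partial>P) = (\<integral>\<^sup>+\<omega>. v \<omega> \<partial>P)"
    by (intro nn_integral_cong) simp
  also have "ennreal (1 / thr) * \<dots> \<le> ennreal (1 / thr) * ennreal e"
    by (intro mult_left_mono int) simp
  finally have "emeasure P B \<le> ennreal (1 / thr * e)"
    using thr by (simp add: ennreal_mult[symmetric] e_def)
  then have "measure P B \<le> 1 / thr * e"
    using thr by (simp add: P.emeasure_eq_measure e_def)
  also have "1 / thr = (2 * d) ^ d / (a * \<tau> ^ d)"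
    by (simp add: thr_def \<eta>_def power_mult_distrib power_divide)
  finally have "measure P B \<le> (2 * d) ^ d / (a * \<tau> ^ d) * e" .
  moreover have "B \<in> sets P" unfolding B_def by measurable
  moreover have "\<exists>k\<in>I. dist y (Z k \<omega>) \<le> \<tau>" if \<omega>: "\<omega> \<in> space P - B" and y: "y \<in> S" for \<omega> y
  proof (rule ccontr)
    assume no: "\<not> (\<exists>k\<in>I. dist y (Z k \<omega>) \<le> \<tau>)"
    \<comment> \<open>By the triangle inequality one uncovered point exposes its whole neighbourhood
      in \<open>S\<close>, at the smaller radius.\<close>
    have "S \<inter> ball y (\<eta> * \<tau>) \<subseteq> Pair \<omega> -` Q"
    proof
      fix z assume z: "z \<in> S \<inter> ball y (\<eta> * \<tau>)"
      have "(1 - \<eta>) * \<tau> < dist z (Z k \<omega>)" if "k \<in> I" for k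
      proof -
        have "\<tau> < dist y (Z k \<omega>)" using no that by force
        moreover have "dist y (Z k \<omega>) \<le> dist y z + dist z (Z k \<omega>)" by (rule dist_triangle)
        ultimately show ?thesis using z by (auto simp: algebra_simps)
      qed
      then show "z \<in> Pair \<omega> -` Q" using z \<omega> by (auto simp: Q_def space_pair_measure)
    qed
    then have "measure \<mu> (S \<inter> ball y (\<eta> * \<tau>)) \<le> measure \<mu> (Pair \<omega> -` Q)"
      by (intro finite_measure_mono) (use Q in \<open>auto intro: sets_Pair1\<close>)
    \<comment> \<open>\<open>S\<close> has full measure, so intersecting with it loses no
      mass.\<close>
    moreover have "measure \<mu> (S \<inter> ball y (\<eta> * \<tau>)) = measure \<mu> (ball y (\<eta> * \<tau>))"
      unfolding Int_commute[of S] using full prob_space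
      by (intro measure_space_inter) (auto simp: sets_mu S_borel)
    moreover have "thr \<le> measure \<mu> (ball y (\<eta> * \<tau>))"
      unfolding thr_def d_def using y \<eta> \<tau> by (intro lower) (auto intro: order_trans[OF mult_left_le_one_le])
    ultimately have "thr \<le> measure \<mu> (Pair \<omega> -` Q)" by linarith
    then have "1 \<le> ennreal (1 / thr) * v \<omega>"
      using thr by (simp add: v_def emeasure_eq_measure ennreal_mult[symmetric] del: ennreal_1 add: ennreal_1[symmetric])
    then show False using \<omega> by (auto simp: B_def)
  qed
  ultimately show thesis
    using that unfolding d_def e_def by blast
qed

end

lemma one_le_ln_ratio:
  fixes m :: nat and \<delta> :: real
  assumes "0 < \<delta>" "\<delta> < 1" "m \<ge> 1"
  shows "1 \<le> ln (12 * m / \<delta>)"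
proof -
  have "exp 1 \<le> (3 :: real)" by (rule exp_le)
  also have "\<dots> \<le> 12 * m / \<delta>"
    using assms by (simp add: field_simps)
  finally show ?thesis
    using assms by (subst ln_ge_iff) auto
qed

text \<open>With \<open>y = \<delta> / (12 * m)\<close> the exponential is
  \<open>y ^ (16 * d)\<close>. The prefactor is at most \<open>m ^ (d + 1)\<close>, since 2 d \<le>
  \<open>u\<close> \<le> \<open>m\<close> and 1 \<le> \<open>u\<close>. As
  \<open>d + 2 \<le> 16 * d\<close> and \<open>m * y \<le> 1\<close>, the powers of \<open>m\<close>
  are absorbed by \<open>d + 1\<close> powers of \<open>y\<close>, and the remaining one is at most
  \<delta>.\<close>

lemma covering_constant:
  fixes m d :: nat and \<delta> u :: real
  defines "u \<equiv> 32 * real d * ln (12 * m / \<delta>)"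
  assumes d: "d \<ge> 1" and \<delta>: "0 < \<delta>" "\<delta> < 1" and m: "m \<ge> 1" "u \<le> m"
  shows "(2 * real d) ^ d * (m / u) * exp (- (u / 2)) \<le> \<delta>"
proof -
  define y where "y = \<delta> / (12 * m)"
  have y: "0 < y" "y \<le> 1" "m * y \<le> 1" "y \<le> \<delta>"
    using \<delta> m by (auto simp: y_def field_simps intro: order_trans[of _ 1])
  note ln1 = one_le_ln_ratio[OF \<delta> m(1)]
  have ud: "32 * real d * 1 \<le> u" unfolding u_def using ln1 by (intro mult_left_mono) auto
  then have u1: "1 \<le> u" using d by linarith
  have h1: "(2 * real d) ^ d \<le> m ^ d"
    using ud m unfolding of_nat_power by (intro power_mono) auto
  have h2: "m / u \<le> m" using u1 mult_right_mono[of 1 u "real m"] by (simp add: field_simps)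
  have h3: "exp (- (u / 2)) = y ^ (16 * d)"
  proof -
    have "ln y = - ln (12 * m / \<delta>)"
      using \<delta> m by (simp add: y_def ln_div)
    then have "- (u / 2) = real (16 * d) * ln y"
      by (simp add: u_def)
    then have "exp (- (u / 2)) = exp (ln y) ^ (16 * d)" by (simp only: exp_of_nat_mult)
    then show ?thesis using y by simp
  qed
  have "(2 * real d) ^ d * (m / u) \<le> m ^ d * m"
    using mult_mono[OF h1 h2] u1 by simp
  then have "(2 * real d) ^ d * (m / u) * exp (- (u / 2)) \<le> m ^ d * m * y ^ (16 * d)"
    unfolding h3 using y by (intro mult_right_mono) auto
  also have "\<dots> \<le> m ^ d * m * y ^ (d + 2)"
    using y d by (intro mult_left_mono power_decreasing) auto
  also have "\<dots> = (m * y) ^ (d + 1) * y"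
    by (simp add: power_mult_distrib mult_ac)
  also have "\<dots> \<le> 1 * y"
    using y by (intro mult_right_mono power_le_one) auto
  finally show ?thesis using y by simp
qed

section \<open>Bounded densities on regular supports\<close>

lemma emeasure_lborel_subset_cball:
  fixes x :: "'a::euclidean_space"
  assumes "A \<subseteq> cball x t"
  shows "emeasure lborel A < top"
  using emeasure_mono[OF assms, of lborel] emeasure_lborel_cball_finite[of x t]
  by (auto intro: le_less_trans)

lemma measure_lborel_annulus:
  fixes x :: "'a::euclidean_space"
  assumes "0 \<le> t" "0 \<le> s"
  shows "measure lborel (cball x (t + s) - ball x t) = unit_ball_vol DIM('a) * ((t + s) ^ DIM('a) - t ^ DIM('a))"
proof -
  have "emeasure lborel (ball x t) \<noteq> \<infinity>" "emeasure lborel (cball x t) \<noteq> \<infinity>" for t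
    using emeasure_lborel_subset_cball[of "ball x t" x t] emeasure_lborel_subset_cball[of "cball x t" x t] by auto
  then show ?thesis
    using assms by (subst measure_Diff) (auto simp: content_ball content_cball algebra_simps)
qed

lemma bounded_density_bounds:
  fixes X :: "'w \<Rightarrow> 'a::euclidean_space"
  assumes P: "prob_space P" and X: "\<forall>\<omega>\<in>space P. X \<omega> \<in> S"
    and S [measurable]: "S \<in> sets borel" and dens: "bounded_density_on P X S f b M"
    and A [measurable]: "A \<in> sets borel" and fin: "emeasure lborel A < \<infinity>"
  shows "measure (distr P borel X) A \<le> M * measure lborel A"
    and "b * measure lborel (S \<inter> A) \<le> measure (distr P borel X) A"
proof -
  interpret P: prob_space P by fact
  have X' [measurable]: "X \<in> borel_measurable P" and f: "(\<lambda>x. ennreal (f x * indicator S x)) \<in> borel_measurable borel"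
    and law: "distr P lborel X = density lborel (\<lambda>x. ennreal (f x * indicator S x))"
    and b: "0 < b" and fb: "\<And>x. x \<in> S \<Longrightarrow> b \<le> f x \<and> f x \<le> M"
    using dens by (auto simp: bounded_density_on_def distributed_def)
  interpret \<mu>: prob_space "distr P borel X" by (rule P.prob_space_distr) simp
  \<comment> \<open>Any value of \<open>X\<close> is a point of \<open>S\<close>, and the density
    bounds there place \<open>M\<close> above the positive \<open>b\<close>.\<close>
  obtain \<omega> where "\<omega> \<in> space P" using P.not_empty by auto
  then have M: "0 \<le> M" using X fb b by fastforce
  have "distr P borel X = distr P lborel X" by (rule distr_cong) auto
  then have eq: "emeasure (distr P borel X) A = (\<integral>\<^sup>+x. ennreal (f x * indicator S x) * indicator A x \<partial>lborel)"
    unfolding law using f by (simp add: emeasure_density)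
  have finS: "emeasure lborel (S \<inter> A) < \<infinity>"
    by (rule le_less_trans[OF emeasure_mono fin]) auto
  have "(\<integral>\<^sup>+x. ennreal (f x * indicator S x) * indicator A x \<partial>lborel) \<le> (\<integral>\<^sup>+x. ennreal M * indicator A x \<partial>lborel)"
    using fb M by (intro nn_integral_mono) (auto simp: indicator_def intro!: ennreal_leI)
  also have "\<dots> = ennreal (M * measure lborel A)"
    using fin M by (simp add: nn_integral_cmult_indicator emeasure_eq_ennreal_measure ennreal_mult)
  finally show "measure (distr P borel X) A \<le> M * measure lborel A"
    using M unfolding eq[symmetric] by (simp add: \<mu>.emeasure_eq_measure)
  have "ennreal (b * measure lborel (S \<inter> A)) = (\<integral>\<^sup>+x. ennreal b * indicator (S \<inter> A) x \<partial>lborel)"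
    using finS b by (simp add: nn_integral_cmult_indicator emeasure_eq_ennreal_measure ennreal_mult)
  also have "\<dots> \<le> (\<integral>\<^sup>+x. ennreal (f x * indicator S x) * indicator A x \<partial>lborel)"
    using fb by (intro nn_integral_mono) (auto simp: indicator_def intro!: ennreal_leI)
  finally show "b * measure lborel (S \<inter> A) \<le> measure (distr P borel X) A"
    unfolding eq[symmetric] by (simp add: \<mu>.emeasure_eq_measure)
qed

lemma ball_regular_density:
  fixes X :: "'w \<Rightarrow> 'a::euclidean_space"
  assumes P: "prob_space P" and X: "\<forall>\<omega>\<in>space P. X \<omega> \<in> S"
    and supp: "regular_support S \<rho>0 c T0" and dens: "bounded_density_on P X S f b M"
  shows "ball_regular (distr P borel X) S (b * c * unit_ball_vol DIM('a)) (M * unit_ball_vol DIM('a)) T0"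
proof -
  interpret P: prob_space P by fact
  have S [measurable]: "S \<in> sets borel" and c: "0 < c" and T0: "0 < T0"
    and reg: "\<And>\<tau> x. 0 < \<tau> \<Longrightarrow> \<tau> \<le> T0 \<Longrightarrow> x \<in> S \<Longrightarrow>
      c * measure lborel (cball x \<tau>) \<le> measure lborel (S \<inter> cball x \<tau>)"
    using supp by (auto simp: regular_support_def)
  have X' [measurable]: "X \<in> borel_measurable P" and b: "0 < b"
    using dens by (auto simp: bounded_density_on_def distributed_def)
  interpret \<mu>: prob_space "distr P borel X" by (rule P.prob_space_distr) simp
  note bounds = bounded_density_bounds[OF P X S dens]
  show ?thesis
  proof (unfold_locales)
    have "X -` S \<inter> space P = space P" using X by auto
    then show "\<mu>.prob S = 1" by (simp add: measure_distr P.prob_space)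
    show "0 < b * c * unit_ball_vol DIM('a)" using b c by simp
  next
    fix x :: 'a and t :: real
    assume x: "x \<in> S" and t: "0 \<le> t" "t \<le> T0"
    show "b * c * unit_ball_vol DIM('a) * t ^ DIM('a) \<le> \<mu>.prob (ball x t)"
    proof (cases "t = 0")
      case False
      have "c * (unit_ball_vol DIM('a) * t ^ DIM('a)) = c * measure lborel (cball x t)"
        using t by (simp add: content_cball)
      also have "\<dots> \<le> measure lborel (S \<inter> cball x t)" using reg x t False by simp
      \<comment> \<open>The support condition concerns closed balls; the sphere is an annulus of
        width zero and hence null.\<close>
      also have "\<dots> \<le> measure lborel (S \<inter> ball x t \<union> (cball x t - ball x t))"
        by (rule measure_mono_fmeasurable) (auto simp: fmeasurable_def intro!: emeasure_lborel_subset_cball[of _ x t])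
      also have "\<dots> \<le> measure lborel (S \<inter> ball x t) + measure lborel (cball x t - ball x t)"
        by (rule measure_Un_le) auto
      finally have "c * (unit_ball_vol DIM('a) * t ^ DIM('a)) \<le> measure lborel (S \<inter> ball x t)"
        using measure_lborel_annulus[OF t(1) order_refl, of x] by simp
      then have "b * (c * (unit_ball_vol DIM('a) * t ^ DIM('a))) \<le> b * measure lborel (S \<inter> ball x t)"
        using b by simp
      also have "\<dots> \<le> \<mu>.prob (ball x t)"
        by (rule bounds(2)) (auto intro!: emeasure_lborel_subset_cball[of _ x t])
      finally show ?thesis by (simp add: mult.assoc)
    qed (simp add: power_0_left)
  next
    fix x :: 'a and t s :: real
    assume t: "0 \<le> t" and s: "0 \<le> s"
    have "\<mu>.prob (cball x (t + s) - ball x t) \<le> M * measure lborel (cball x (t + s) - ball x t)"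
      by (rule bounds(1)) (auto intro!: emeasure_lborel_subset_cball[of _ x "t + s"])
    then show "\<mu>.prob (cball x (t + s) - ball x t) \<le>
        M * unit_ball_vol DIM('a) * ((t + s) ^ DIM('a) - t ^ DIM('a))"
      using measure_lborel_annulus[OF t s, of x] by (simp add: mult.assoc)
  qed (use T0 in auto)
qed

text \<open>Compare both sides of the support condition at radius \<open>T0\<close>. The result
  yields \<open>c * b \<le> M\<close>, which keeps the spacing \<open>s\<close> below the scale
  \<open>r\<close>.\<close>

lemma support_constant_le_one:
  assumes "regular_support S \<rho>0 c T0" "x \<in> S"
  shows "c \<le> 1"
proof -
  have T0: "0 < T0" and S: "S \<in> sets borel"
    and *: "c * measure lborel (cball x T0) \<le> measure lborel (S \<inter> cball x T0)"
    using assms by (auto simp: regular_support_def)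
  have "measure lborel (S \<inter> cball x T0) \<le> measure lborel (cball x T0)"
    by (rule measure_mono_fmeasurable) (use S in \<open>auto simp: fmeasurable_def intro!: emeasure_lborel_subset_cball\<close>)
  with * have "c * measure lborel (cball x T0) \<le> 1 * measure lborel (cball x T0)" by simp
  moreover have "0 < measure lborel (cball x T0)" using T0 by simp
  ultimately show ?thesis by (rule mult_right_le_imp_le)
qed

section \<open>Voronoi cells\<close>

lemma nn_index_minimal:
  assumes "m \<ge> 1"
  shows "nn_index z m x \<in> {1..m}" "j \<in> {1..m} \<Longrightarrow> dist x (z (nn_index z m x)) \<le> dist x (z j)"
proof -
  define K where "K = {k \<in> {1..m}. \<forall>j\<in>{1..m}. norm (x - z k) \<le> norm (x - z j)}"
  have "finite K" by (simp add: K_def)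
  moreover have "arg_min_on (\<lambda>k. norm (x - z k)) {1..m} \<in> K"
    unfolding K_def using arg_min_if_finite[of "{1..m}" "\<lambda>k. norm (x - z k)"] assms
    by (auto simp: arg_min_least)
  ultimately have "nn_index z m x \<in> K"
    unfolding nn_index_def K_def[symmetric] by (intro Max_in) auto
  then show "nn_index z m x \<in> {1..m}" "j \<in> {1..m} \<Longrightarrow> dist x (z (nn_index z m x)) \<le> dist x (z j)"
    by (auto simp: K_def dist_norm)
qed

lemma nn_index_eqI:
  assumes "k \<in> {1..m}" "\<And>j. j \<in> {1..m} - {k} \<Longrightarrow> dist x (z k) < dist x (z j)"
  shows "nn_index z m x = k"
proof (rule ccontr)
  assume neq: "nn_index z m x \<noteq> k"
  have m: "m \<ge> 1" using assms(1) by auto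
  from nn_index_minimal(1)[OF m] neq have "dist x (z k) < dist x (z (nn_index z m x))"
    by (intro assms(2)) auto
  moreover have "dist x (z (nn_index z m x)) \<le> dist x (z k)"
    by (rule nn_index_minimal(2)[OF m assms(1)])
  ultimately show False by simp
qed

text \<open>Both points are within \<tau> of one and the same prototype.\<close>

lemma dist_voronoi_cell:
  assumes m: "m \<ge> 1" and cover: "\<And>y. y \<in> S \<Longrightarrow> \<exists>k\<in>{1..m}. dist y (z k) \<le> \<tau>"
    and x: "x \<in> S" and y: "y \<in> voronoi_cell_at S z m x"
  shows "dist y x \<le> 2 * \<tau>"
proof -
  have near: "dist w (nearest z m w) \<le> \<tau>" if "w \<in> S" for w
    using cover[OF that] nn_index_minimal(2)[OF m] unfolding nearest_def by (meson order_trans)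
  have "nearest z m y = nearest z m x" "y \<in> S"
    using y by (auto simp: voronoi_cell_at_def voronoi_cell_def nearest_def)
  then show ?thesis
    using near[OF x] near[of y] dist_triangle2[of y x "nearest z m x"] by auto
qed

text \<open>Moving by at most \<open>s / 2\<close> changes each distance by at most
  \<open>s / 2\<close>, so a gap above \<open>s\<close> cannot be closed.\<close>

lemma ball_subset_voronoi_cell:
  assumes k: "k \<in> {1..m}" and gap: "\<And>j. j \<in> {1..m} - {k} \<Longrightarrow> dist x (z k) + s < dist x (z j)" and s: "0 \<le> s"
  shows "S \<inter> cball x (s / 2) \<subseteq> voronoi_cell_at S z m x"
proof
  fix y assume y: "y \<in> S \<inter> cball x (s / 2)"
  have "nn_index z m x = k"
    using gap s by (intro nn_index_eqI[OF k]) force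
  moreover have "nn_index z m y = k"
  proof (rule nn_index_eqI[OF k])
    fix j assume "j \<in> {1..m} - {k}"
    then show "dist y (z k) < dist y (z j)"
      using gap[of j] y dist_triangle[of y "z k" x] dist_triangle[of x "z j" y] by (simp add: dist_commute)
  qed
  ultimately show "y \<in> voronoi_cell_at S z m x"
    using y by (simp add: voronoi_cell_at_def voronoi_cell_def nearest_def)
qed

text \<open>Joint measurability in the prototypes and the tested point is what Fubini over the
  prototypes calls for; constant prototypes give that each cell is Borel.\<close>

lemma measurable_voronoi_cell [measurable (raw)]:
  assumes m: "m \<ge> 1" and S [measurable]: "S \<in> sets borel"
    and z: "\<And>k. k \<in> {1..m} \<Longrightarrow> (\<lambda>\<omega>. z \<omega> k) \<in> borel_measurable M"
    and y [measurable]: "y \<in> borel_measurable M"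
  shows "Measurable.pred M (\<lambda>\<omega>. y \<omega> \<in> voronoi_cell_at S (z \<omega>) m x)"
proof -
  note [measurable] = z
  have nn: "Measurable.pred M (\<lambda>\<omega>. nn_index (z \<omega>) m (w \<omega>) = k)"
    if [measurable]: "w \<in> borel_measurable M" for w k
  proof -
    have "Measurable.pred M (\<lambda>\<omega>. i \<in> {1..m} \<and> (\<forall>j\<in>{1..m}. norm (w \<omega> - z \<omega> i) \<le> norm (w \<omega> - z \<omega> j)))" for i
    proof (cases "i \<in> {1..m}")
      case True
      then show ?thesis by measurable
    qed simp
    then have [measurable]: "(\<lambda>\<omega>. nn_index (z \<omega>) m (w \<omega>)) \<in> M \<rightarrow>\<^sub>M count_space UNIV"
      unfolding nn_index_def by (rule measurable_Max_nat)
    show ?thesis by measurable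
  qed
  \<comment> \<open>Finitely many index values reduce the claim to measurable pieces; equality of
    two prototypes is written as \<open>dist \<le> 0\<close> to be a comparison of real
    functions.\<close>
  have eq: "y \<omega> \<in> voronoi_cell_at S (z \<omega>) m x \<longleftrightarrow> y \<omega> \<in> S \<and> (\<exists>k\<in>{1..m}. \<exists>l\<in>{1..m}.
    nn_index (z \<omega>) m (y \<omega>) = k \<and> nn_index (z \<omega>) m x = l \<and> dist (z \<omega> k) (z \<omega> l) \<le> 0)" for \<omega>
    using nn_index_minimal(1)[OF m] by (auto simp: voronoi_cell_at_def voronoi_cell_def nearest_def)
  have yS: "Measurable.pred M (\<lambda>\<omega>. y \<omega> \<in> S)" by measurable
  have zz: "Measurable.pred M (\<lambda>\<omega>. dist (z \<omega> k) (z \<omega> l) \<le> 0)" if "k \<in> {1..m}" "l \<in> {1..m}" for k l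
    using that by measurable
  show ?thesis
    unfolding eq
    by (intro pred_intros_logic pred_intros_finite yS zz nn y borel_measurable_const finite_atLeastAtMost)
qed

text \<open>Each residual splits into the noise \<open>ys i - g (xs i)\<close> and the bias
  \<open>g (xs i) - g x\<close>. The bias is averaged with weights that sum to one, so its bound
  \<open>C\<close> passes through.\<close>

lemma proto_nn_error:
  fixes S :: "'a::euclidean_space set" and z xs :: "nat \<Rightarrow> 'a" and ys :: "nat \<Rightarrow> real"
    and g :: "'a \<Rightarrow> real" and x :: 'a and m n :: nat and \<beta> C :: real
  defines "V \<equiv> voronoi_cell_at S z m x"
  defines "N \<equiv> (\<Sum>i=1..n. indicator V (xs i) :: real)"
  assumes N: "0 < N" and noise: "\<bar>\<Sum>i=1..n. (ys i - g (xs i)) * indicator V (xs i)\<bar> \<le> \<beta>"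
    and bias: "\<And>y. y \<in> V \<Longrightarrow> \<bar>g y - g x\<bar> \<le> C"
  shows "\<bar>proto_nn S z m xs ys n x - g x\<bar> \<le> \<beta> / N + C"
proof -
  let ?e = "\<Sum>i=1..n. (ys i - g (xs i)) * indicator V (xs i)"
  let ?b = "\<Sum>i=1..n. (g (xs i) - g x) * indicator V (xs i)"
  have "(\<Sum>i=1..n. ys i * indicator V (xs i)) = ?e + ?b + g x * N"
    unfolding N_def sum_distrib_left sum.distrib[symmetric]
    by (intro sum.cong) (simp_all add: algebra_simps)
  then have "proto_nn S z m xs ys n x = (?e + ?b + g x * N) / N"
    unfolding proto_nn_def V_def N_def by (simp only:)
  then have "proto_nn S z m xs ys n x - g x = (?e + ?b) / N"
    using N by (simp only: add_divide_distrib) simp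
  moreover have "\<bar>?b\<bar> \<le> C * N"
  proof -
    have "\<bar>?b\<bar> \<le> (\<Sum>i=1..n. \<bar>(g (xs i) - g x) * indicator V (xs i)\<bar>)" by (rule sum_abs)
    also have "\<dots> \<le> (\<Sum>i=1..n. C * indicator V (xs i))"
      using bias by (intro sum_mono) (auto simp: indicator_def)
    finally show ?thesis by (simp add: N_def sum_distrib_left)
  qed
  then have "\<bar>(?e + ?b) / N\<bar> \<le> (\<beta> + C * N) / N"
    using noise N by (simp add: abs_divide divide_right_mono)
  ultimately show ?thesis using N by (simp add: add_divide_distrib)
qed

text \<open>Independence is formulated for the prototypes as a point of a finite product, that is, a
  function equal to \<open>undefined\<close> off \<open>{0..m}\<close>. This lemma passes between it
  and the full sequence.\<close>

lemma voronoi_cell_at_cong: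
  assumes m: "m \<ge> 1" and z: "\<And>k. k \<in> {1..m} \<Longrightarrow> z k = z' k"
  shows "voronoi_cell_at S z m x = voronoi_cell_at S z' m x"
proof -
  have "nn_index z m y = nn_index z' m y" for y
    unfolding nn_index_def by (rule arg_cong[where f=Max]) (use z in auto)
  then show ?thesis
    using nn_index_minimal(1)[OF m, of z'] z by (simp add: voronoi_cell_at_def voronoi_cell_def nearest_def)
qed

lemma voronoi_cell_at_subset: "voronoi_cell_at S z m x \<subseteq> S"
  by (auto simp: voronoi_cell_at_def voronoi_cell_def)


text \<open>For frozen prototypes the cell is a fixed Borel set and \<open>cell_tail\<close>
  applies; independence of prototypes and data then averages the bound. The cell enters only through
  the mass forced by the ball around \<open>x\<close> that it contains.\<close>

lemma cell_tail_joint: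
  fixes X Z :: "nat \<Rightarrow> 'w \<Rightarrow> 'a::euclidean_space" and Y :: "nat \<Rightarrow> 'w \<Rightarrow> real"
    and q v l s :: real and m n :: nat
  defines "V \<equiv> \<lambda>S x m \<omega>. voronoi_cell_at S (\<lambda>k. Z k \<omega>) m x"
  defines "N \<equiv> \<lambda>S x m n \<omega>. \<Sum>i=1..n. indicator (V S x m \<omega>) (X i \<omega>) :: real"
  assumes P: "prob_space P"
    and ind: "prob_space.indep_vars P (\<lambda>_. borel) (\<lambda>i \<omega>. (X i \<omega>, Y i \<omega>)) {1..n}"
    and ZX: "indep_rvs P
          (PiM {0..n} (\<lambda>_. borel)) (\<lambda>\<omega>. \<lambda>i\<in>{0..n}. (X i \<omega>, Y i \<omega>))
          (PiM {0..m} (\<lambda>_. borel)) (\<lambda>\<omega>. \<lambda>k\<in>{0..m}. Z k \<omega>)"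
    and m: "m \<ge> 1" and S: "S \<in> sets borel" and e [measurable]: "e \<in> borel_measurable borel"
    and law: "\<And>i. i \<in> {1..n} \<Longrightarrow> distr P borel (X i) = \<mu>"
    and mgf: "\<And>i t A. i \<in> {1..n} \<Longrightarrow> A \<in> sets borel \<Longrightarrow>
      (\<integral>\<^sup>+\<omega>. ennreal (exp (t * e (X i \<omega>, Y i \<omega>))) * indicator A (X i \<omega>) \<partial>P)
      \<le> ennreal (exp (t\<^sup>2 * v / 2) * measure P {\<omega> \<in> space P. X i \<omega> \<in> A})"
    and mass: "\<And>A. A \<in> sets borel \<Longrightarrow> S \<inter> cball x (s / 2) \<subseteq> A \<Longrightarrow> q \<le> measure \<mu> A"
    and s: "0 \<le> s" and q: "0 \<le> q" and v: "0 \<le> v" and l: "0 < l" "l \<le> real n * q / 8"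
  obtains B where "B \<in> sets P" "measure P B \<le> 3 * exp (- l)"
    "\<And>\<omega>. \<omega> \<in> space P - B \<Longrightarrow> \<exists>k\<in>{1..m}. \<forall>j\<in>{1..m} - {k}. dist x (Z k \<omega>) + s < dist x (Z j \<omega>) \<Longrightarrow>
      real n * q / 2 \<le> N S x m n \<omega> \<and>
      \<bar>\<Sum>i=1..n. e (X i \<omega>, Y i \<omega>) * indicator (V S x m \<omega>) (X i \<omega>)\<bar> \<le> sqrt (2 * v * l * N S x m n \<omega>)"
proof -
  interpret P: prob_space P by fact
  let ?PD = "PiM {0..n} (\<lambda>_. borel) :: (nat \<Rightarrow> 'a \<times> real) measure"
  let ?PZ = "PiM {0..m} (\<lambda>_. borel) :: (nat \<Rightarrow> 'a) measure"
  let ?D = "\<lambda>\<omega>. \<lambda>i\<in>{0..n}. (X i \<omega>, Y i \<omega>)"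
  let ?Z = "\<lambda>\<omega>. \<lambda>k\<in>{0..m}. Z k \<omega>"
  have DZ [measurable]: "?D \<in> measurable P ?PD" "?Z \<in> measurable P ?PZ"
    using ZX by (auto simp: indep_rvs_def)
  have W: "(\<lambda>\<omega>. (X i \<omega>, Y i \<omega>)) \<in> borel_measurable P" if "i \<in> {1..n}" for i
    using ind that unfolding P.indep_vars_def by auto
  have [measurable]: "X i \<in> borel_measurable P" if "i \<in> {1..n}" for i
    using measurable_compose[OF W[OF that] borel_measurable_continuous_onI[OF continuous_on_fst[OF continuous_on_id]]] by simp
  define C where "C z = voronoi_cell_at S z m x" for z
  have C_borel: "C z \<in> sets borel" for z
  proof -
    have "Measurable.pred borel (\<lambda>y. y \<in> C z)"
      unfolding C_def by (rule measurable_voronoi_cell[OF m S]) auto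
    then show ?thesis by (simp add: pred_def)
  qed
  define G where "G z \<longleftrightarrow> (\<exists>k\<in>{1..m}. \<forall>j\<in>{1..m} - {k}. dist x (z k) + s < dist x (z j))" for z :: "nat \<Rightarrow> 'a"
  define cnt where "cnt z w = (\<Sum>i=1..n. indicator (C z) (fst (w i)) :: real)" for z and w :: "nat \<Rightarrow> 'a \<times> real"
  define noise where "noise z w = (\<Sum>i=1..n. e (w i) * indicator (C z) (fst (w i)))" for z w
  define bad where "bad z w \<longleftrightarrow> cnt z w < real n * q / 2 \<or> sqrt (2 * v * l * cnt z w) < \<bar>noise z w\<bar>" for z w
  \<comment> \<open>The gap \<open>G\<close> is part of the bad set: the slices without it are
    empty, and those with it have a cell of mass at least \<open>q\<close>, so the same bound holds
    for every frozen \<open>z\<close>.\<close>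
  define H where "H = {p \<in> space (?PZ \<Otimes>\<^sub>M ?PD). G (fst p) \<and> bad (fst p) (snd p)}"
  have H: "H \<in> sets (?PZ \<Otimes>\<^sub>M ?PD)"
  proof -
    have w [measurable]: "(\<lambda>p. snd p i) \<in> borel_measurable (?PZ \<Otimes>\<^sub>M ?PD)" if "i \<in> {1..n}" for i
      using that by (intro measurable_compose[OF measurable_snd measurable_component_singleton]) auto
    have z [measurable]: "(\<lambda>p. fst p k) \<in> borel_measurable (?PZ \<Otimes>\<^sub>M ?PD)" if "k \<in> {1..m}" for k
      using that by (intro measurable_compose[OF measurable_fst measurable_component_singleton]) auto
    have y [measurable]: "(\<lambda>p. fst (snd p i)) \<in> borel_measurable (?PZ \<Otimes>\<^sub>M ?PD)" if "i \<in> {1..n}" for i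
      using measurable_compose[OF w[OF that] borel_measurable_continuous_onI[OF continuous_on_fst[OF continuous_on_id]]] by simp
    have ew [measurable]: "(\<lambda>p. e (snd p i)) \<in> borel_measurable (?PZ \<Otimes>\<^sub>M ?PD)" if "i \<in> {1..n}" for i
      using measurable_compose[OF w[OF that] e] by simp
    have cell: "Measurable.pred (?PZ \<Otimes>\<^sub>M ?PD) (\<lambda>p. fst (snd p i) \<in> C (fst p))" if "i \<in> {1..n}" for i
      unfolding C_def by (rule measurable_voronoi_cell[OF m S]) (use that z y in auto)
    have ind [measurable]: "(\<lambda>p. indicator (C (fst p)) (fst (snd p i)) :: real) \<in> borel_measurable (?PZ \<Otimes>\<^sub>M ?PD)"
      if "i \<in> {1..n}" for i
      unfolding indicator_def of_bool_def by (intro measurable_If borel_measurable_const cell[OF that, unfolded pred_def])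
    have [measurable]: "(\<lambda>p. cnt (fst p) (snd p)) \<in> borel_measurable (?PZ \<Otimes>\<^sub>M ?PD)"
      unfolding cnt_def by (intro borel_measurable_sum ind)
    have [measurable]: "(\<lambda>p. noise (fst p) (snd p)) \<in> borel_measurable (?PZ \<Otimes>\<^sub>M ?PD)"
      unfolding noise_def by (intro borel_measurable_sum borel_measurable_times ind ew)
    have G [measurable]: "Measurable.pred (?PZ \<Otimes>\<^sub>M ?PD) (\<lambda>p. G (fst p))"
      unfolding G_def by measurable
    show ?thesis unfolding H_def bad_def by measurable
  qed
  have "measure P {\<omega> \<in> space P. (?Z \<omega>, ?D \<omega>) \<in> H} \<le> 3 * exp (- l)"
  proof (rule indep_rvs_fubini_bound[OF P ZX H])
    fix z assume z: "z \<in> space ?PZ"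
    show "measure P {\<omega> \<in> space P. (z, ?D \<omega>) \<in> H} \<le> 3 * exp (- l)"
    proof (cases "G z")
      case False
      then have "{\<omega> \<in> space P. (z, ?D \<omega>) \<in> H} = {}" by (auto simp: H_def)
      then show ?thesis by (simp only: measure_empty) simp
    next
      case True
      then obtain k where k: "k \<in> {1..m}" "\<And>j. j \<in> {1..m} - {k} \<Longrightarrow> dist x (z k) + s < dist x (z j)"
        unfolding G_def by blast
      then have "S \<inter> cball x (s / 2) \<subseteq> C z"
        unfolding C_def using s by (intro ball_subset_voronoi_cell[where k=k]) auto
      then have qC: "q \<le> measure \<mu> (C z)" by (rule mass[OF C_borel])
      have qX: "q \<le> measure P {\<omega> \<in> space P. X i \<omega> \<in> C z}" if i: "i \<in> {1..n}" for i
      proof -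
        have "measure \<mu> (C z) = measure P (X i -` C z \<inter> space P)"
          using i C_borel by (subst law[OF i, symmetric], subst measure_distr) auto
        also have "X i -` C z \<inter> space P = {\<omega> \<in> space P. X i \<omega> \<in> C z}" by auto
        finally show ?thesis using qC by simp
      qed
      have "P.prob {\<omega> \<in> space P. (\<Sum>i=1..n. indicator (C z) (X i \<omega>)) < card {1..n} * q / 2 \<or>
        sqrt (2 * v * l * (\<Sum>i=1..n. indicator (C z) (X i \<omega>))) <
          \<bar>\<Sum>i=1..n. e (X i \<omega>, Y i \<omega>) * indicator (C z) (X i \<omega>)\<bar>} \<le> 3 * exp (- l)"
        by (rule P.cell_tail[OF ind finite_atLeastAtMost C_borel e mgf[OF _ C_borel] qX q v l(1)]) (use l in auto)
      moreover have "{\<omega> \<in> space P. (z, ?D \<omega>) \<in> H} =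
        {\<omega> \<in> space P. (\<Sum>i=1..n. indicator (C z) (X i \<omega>)) < card {1..n} * q / 2 \<or>
        sqrt (2 * v * l * (\<Sum>i=1..n. indicator (C z) (X i \<omega>))) <
          \<bar>\<Sum>i=1..n. e (X i \<omega>, Y i \<omega>) * indicator (C z) (X i \<omega>)\<bar>}"
      proof -
        have "cnt z (?D \<omega>) = (\<Sum>i=1..n. indicator (C z) (X i \<omega>))"
          "noise z (?D \<omega>) = (\<Sum>i=1..n. e (X i \<omega>, Y i \<omega>) * indicator (C z) (X i \<omega>))" for \<omega>
          unfolding cnt_def noise_def by (auto intro!: sum.cong simp: indicator_def)
        moreover have "(z, ?D \<omega>) \<in> space (?PZ \<Otimes>\<^sub>M ?PD)" if "\<omega> \<in> space P" for \<omega>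
          using that z measurable_space[OF DZ(1)] by (simp add: space_pair_measure)
        ultimately show ?thesis
          using True by (intro Collect_cong conj_cong refl) (simp add: H_def bad_def)
      qed
      ultimately show ?thesis by simp
    qed
  qed simp
  moreover have "{\<omega> \<in> space P. (?Z \<omega>, ?D \<omega>) \<in> H} \<in> sets P"
  proof -
    have "(\<lambda>\<omega>. (?Z \<omega>, ?D \<omega>)) \<in> measurable P (?PZ \<Otimes>\<^sub>M ?PD)" by measurable
    from measurable_sets[OF this H] show ?thesis by (simp add: vimage_def Int_def conj_commute)
  qed
  moreover have "real n * q / 2 \<le> N S x m n \<omega> \<and>
      \<bar>\<Sum>i=1..n. e (X i \<omega>, Y i \<omega>) * indicator (V S x m \<omega>) (X i \<omega>)\<bar> \<le> sqrt (2 * v * l * N S x m n \<omega>)"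
    if \<omega>: "\<omega> \<in> space P - {\<omega> \<in> space P. (?Z \<omega>, ?D \<omega>) \<in> H}"
      and gap: "\<exists>k\<in>{1..m}. \<forall>j\<in>{1..m} - {k}. dist x (Z k \<omega>) + s < dist x (Z j \<omega>)" for \<omega>
  proof -
    have "C (?Z \<omega>) = V S x m \<omega>"
      unfolding C_def V_def by (rule voronoi_cell_at_cong[OF m]) auto
    then have eqs: "cnt (?Z \<omega>) (?D \<omega>) = N S x m n \<omega>"
      "noise (?Z \<omega>) (?D \<omega>) = (\<Sum>i=1..n. e (X i \<omega>, Y i \<omega>) * indicator (V S x m \<omega>) (X i \<omega>))"
      unfolding cnt_def noise_def N_def by (auto intro!: sum.cong)
    have "G (?Z \<omega>)" using gap unfolding G_def by force
    moreover have "(?Z \<omega>, ?D \<omega>) \<in> space (?PZ \<Otimes>\<^sub>M ?PD)"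
      using \<omega> measurable_space[OF DZ(1)] measurable_space[OF DZ(2)] by (simp add: space_pair_measure)
    ultimately have "\<not> bad (?Z \<omega>) (?D \<omega>)" using \<omega> by (auto simp: H_def)
    then show ?thesis unfolding bad_def eqs by auto
  qed
  ultimately show thesis using that by blast
qed

section \<open>The error bound\<close>

theorem theorem15:
  fixes P :: "'w measure"
    and X Z :: "nat \<Rightarrow> 'w \<Rightarrow> 'a::euclidean_space"
    and Y :: "nat \<Rightarrow> 'w \<Rightarrow> real"
    and S :: "'a set"
    and g f :: "'a \<Rightarrow> real"
    and L \<sigma> \<rho>0 c T0 b M \<delta> \<psi> Vd :: real
    and n m :: nat
  assumes "prob_space P"
    and X_in_S: "\<forall>\<omega>\<in>space P. X 0 \<omega> \<in> S"
    and data_iid: "iid_family P borel (\<lambda>i \<omega>. (X i \<omega>, Y i \<omega>)) {0..n}"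
    and proto_iid: "iid_family P borel Z {0..m}"
    and same_law: "distr P borel (Z 0) = distr P borel (X 0)"
    and proto_indep_data: "indep_rvs P
          (PiM {0..n} (\<lambda>_. borel)) (\<lambda>\<omega>. \<lambda>i\<in>{0..n}. (X i \<omega>, Y i \<omega>))
          (PiM {0..m} (\<lambda>_. borel)) (\<lambda>\<omega>. \<lambda>k\<in>{0..m}. Z k \<omega>)"
    and regression: "regression_function P (X 0) (Y 0) S g"
    and lipschitz: "L-lipschitz_on S g"
    and subgaussian: "cond_subgaussian P (\<lambda>\<omega>. (X 0 \<omega>, Z 0 \<omega>)) (\<sigma>\<^sup>2) (\<lambda>\<omega>. Y 0 \<omega> - g (X 0 \<omega>))"
    and support: "regular_support S \<rho>0 c T0"
    and density: "bounded_density_on P (X 0) S f b M"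
    and Vd: "Vd = measure lborel (ball (0::'a) 1)"
    and \<delta>: "0 < \<delta>" "\<delta> < 1 / 5"
    and \<psi>: "\<psi> = (18 * M * DIM('a)) ^ DIM('a) * (c * b) powi (- int DIM('a))"
    and nm: "n \<ge> 1" "m \<ge> 3"
    and n_over_m: "real n / real m \<ge> 8 * \<psi> * ln (1 / \<delta>) / \<delta> ^ DIM('a)"
    and m_large: "32 * DIM('a) * ln (12 * m / \<delta>) \<le> T0 ^ DIM('a) * m * b * c * Vd"
  shows "\<forall>x\<in>S. with_prob_at_least P (1 - 5 * \<delta>) (\<lambda>\<omega>.
    \<bar>proto_nn S (\<lambda>k. Z k \<omega>) m (\<lambda>i. X i \<omega>) (\<lambda>i. Y i \<omega>) n x - g x\<bar>
      \<le> sqrt (4 * \<sigma>\<^sup>2 * \<psi> * ln (1 / \<delta>) / \<delta> ^ DIM('a)) * sqrt (real m / real n)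
        + 2 * lip_const g (voronoi_cell_at S (\<lambda>k. Z k \<omega>) m x)
            * (32 * DIM('a) * ln (12 * m / \<delta>) / (m * b * c * Vd)) powr (1 / DIM('a)))"
proof
  fix x assume x: "x \<in> S"
  interpret P: prob_space P by fact

  \<comment> \<open>Constants of the covariate distribution\<close>
  define d where "d = DIM('a)"
  have d: "d \<ge> 1" by (simp add: d_def Suc_leI)
  define \<mu> where "\<mu> = distr P borel (X 0)"
  have Vd': "Vd = unit_ball_vol d" by (simp add: Vd content_ball d_def)
  have Vd_pos: "0 < Vd" by (simp add: Vd')
  have S: "S \<in> sets borel" and c: "0 < c" and T0: "0 < T0"
    using support by (auto simp: regular_support_def)
  have b: "0 < b" "b \<le> M" using density x by (force simp: bounded_density_on_def)+
  have c1: "c \<le> 1" by (rule support_constant_le_one[OF support x])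
  have cbM: "c * b \<le> M" using c1 b c mult_right_mono[of c 1 b] by linarith
  have M: "0 < M" using b by linarith
  define a where "a = b * c * Vd"
  have a: "0 < a" using b c Vd_pos by (simp add: a_def)
  interpret \<mu>: ball_regular \<mu> S a "M * Vd" T0
    unfolding a_def \<mu>_def Vd' d_def by (rule ball_regular_density[OF assms(1) X_in_S support density])

  \<comment> \<open>The covering radius, the typical spacing and the mass of a cell\<close>
  define u where "u = 32 * real d * ln (12 * m / \<delta>)"
  define l where "l = ln (1 / \<delta>)"
  have l: "0 < l" "exp (- l) = \<delta>" using \<delta> by (auto simp: l_def ln_div)
  have u1: "1 \<le> u"
    unfolding u_def using one_le_ln_ratio[of \<delta> m] \<delta> nm d
      mult_mono[of 1 "32 * real d" 1 "ln (12 * m / \<delta>)"] by auto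
  then have u_pos: "0 < u" by simp
  have uT: "u \<le> T0 ^ d * m * a"
    using m_large by (simp add: u_def a_def d_def mult_ac)
  \<comment> \<open>The left side bounds the probability of a ball from below. This gives
    \<open>u \<le> m\<close>, which \<open>covering_constant\<close> requires.\<close>
  have "a * T0 ^ d \<le> 1"
    unfolding d_def by (rule order_trans[OF \<mu>.lower[OF x] \<mu>.prob_le_1]) (use T0 in auto)
  then have um: "u \<le> m"
    using uT mult_left_mono[of "a * T0 ^ d" 1 "real m"] by (simp add: mult_ac)
  have root: "(w powr (1 / d)) ^ d = w" if "0 < w" for w :: real
    using that d by (simp add: powr_realpow[symmetric] powr_powr)
  \<comment> \<open>The covering radius: \<open>m * a * \<tau> ^ d = u\<close>, and the largeness of
    \<open>m\<close> is exactly \<tau> \<le> \<open>T0\<close>.\<close>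
  define \<tau> where "\<tau> = (u / (m * a)) powr (1 / d)"
  have ma: "0 < m * a" using nm a by simp
  have \<tau>d: "\<tau> ^ d = u / (m * a)" unfolding \<tau>_def using u_pos ma by (intro root) simp
  have \<tau>: "0 < \<tau>" using u_pos nm a by (simp add: \<tau>_def)
  have "\<tau> ^ d \<le> T0 ^ d" unfolding \<tau>d using uT ma by (simp add: pos_divide_le_eq mult_ac)
  then have \<tau>T: "\<tau> \<le> T0" using T0 d by (metis less_imp_le power_mono_iff zero_less_iff_neq_zero not_one_le_zero \<tau>)
  \<comment> \<open>The scale at which the mass bound of a ball is \<open>1 / m\<close>.\<close>
  define r where "r = (1 / (m * a)) powr (1 / d)"
  have rd: "r ^ d = 1 / (m * a)" unfolding r_def using ma by (intro root) simp
  have r: "0 < r" using nm a by (simp add: r_def)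
  have mar: "m * a * r ^ d = 1" using nm a by (simp add: rd)
  \<comment> \<open>The factor c b / M compensates the ratio of the upper constant M V_d to
    \<open>a\<close>, so that the spacing bound becomes 4/9 \<delta>.\<close>
  define s where "s = \<delta> * c * b / (9 * M * d) * r"
  have s: "0 < s" using \<delta> c b M d r by (simp add: s_def)
  have ds: "9 * d * s \<le> r"
  proof -
    have "9 * d * s = \<delta> * (c * b / M) * r" using d M by (simp add: s_def)
    also have "\<dots> \<le> 1 * 1 * r"
      using \<delta> cbM M c b r by (intro mult_right_mono mult_mono) auto
    finally show ?thesis by simp
  qed
  define q where "q = a * (s / 2) ^ d"
  \<comment> \<open>Halving \<open>s\<close> turns the 9 in its denominator into the 18 of
    \<psi>.\<close>
  have q_eq: "q = \<delta> ^ d / (\<psi> * m)"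
  proof -
    have "q = a * r ^ d * (\<delta> * (c * b) / (18 * M * d)) ^ d"
      by (simp add: q_def s_def power_mult_distrib[symmetric] mult_ac)
    also have "a * r ^ d = 1 / m" using a nm by (simp add: rd)
    also have "(\<delta> * (c * b) / (18 * M * d)) ^ d = \<delta> ^ d / \<psi>"
      using c b by (simp add: \<psi> d_def power_int_minus power_divide power_mult_distrib field_simps)
    finally show ?thesis by simp
  qed
  have \<psi>_pos: "0 < \<psi>" 
    unfolding \<psi> d_def[symmetric] power_int_minus power_int_of_nat
    using M c b d by (intro mult_pos_pos zero_less_power positive_imp_inverse_positive) auto
  have q: "0 < q" using a s by (simp add: q_def)
  \<comment> \<open>This is the hypothesis on \<open>n / m\<close>, rewritten through
    \<open>q_eq\<close>.\<close>
  have lq: "l \<le> real n * q / 8"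
  proof -
    have "8 * \<psi> * l / \<delta> ^ d * m \<le> n"
      using n_over_m nm by (simp add: l_def d_def pos_le_divide_eq)
    then show ?thesis using \<psi>_pos \<delta> nm by (simp add: q_eq field_simps)
  qed

  \<comment> \<open>Transfer of the hypotheses from the generic copy to the sample\<close>
  have Zall: "P.indep_vars (\<lambda>_. borel) Z {0..m}"
    and Zeq: "\<forall>i\<in>{0..m}. \<forall>j\<in>{0..m}. distr P borel (Z i) = distr P borel (Z j)"
    using proto_iid unfolding iid_family_def by blast+
  have Zind: "P.indep_vars (\<lambda>_. borel) Z {1..m}"
    by (rule P.indep_vars_subset[OF Zall]) simp
  have Zlaw: "distr P borel (Z k) = \<mu>" if "k \<in> {1..m}" for k
    using bspec[OF bspec[OF Zeq, of k], of 0] same_law that by (simp add: \<mu>_def)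
  have Zm: "Z 0 \<in> borel_measurable P"
    using Zall unfolding P.indep_vars_def by auto
  have Wall: "P.indep_vars (\<lambda>_. borel) (\<lambda>i \<omega>. (X i \<omega>, Y i \<omega>)) {0..n}"
    and Weq: "\<forall>i\<in>{0..n}. \<forall>j\<in>{0..n}. distr P borel (\<lambda>\<omega>. (X i \<omega>, Y i \<omega>)) = distr P borel (\<lambda>\<omega>. (X j \<omega>, Y j \<omega>))"
    using data_iid unfolding iid_family_def by blast+
  have Wm: "(\<lambda>\<omega>. (X i \<omega>, Y i \<omega>)) \<in> borel_measurable P" if "i \<in> {0..n}" for i
    using Wall that unfolding P.indep_vars_def by auto
  have fst_m: "fst \<in> borel_measurable (borel :: ('a \<times> real) measure)"
    and snd_m: "snd \<in> borel_measurable (borel :: ('a \<times> real) measure)"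
    by (auto intro!: borel_measurable_continuous_onI continuous_intros)
  have Xm: "X i \<in> borel_measurable P" if "i \<in> {0..n}" for i
    using measurable_compose[OF Wm[OF that] fst_m] by simp
  have Wlaw: "distr P borel (\<lambda>\<omega>. (X i \<omega>, Y i \<omega>)) = distr P borel (\<lambda>\<omega>. (X 0 \<omega>, Y 0 \<omega>))" if "i \<in> {0..n}" for i
    by (rule bspec[OF bspec[OF Weq that]]) simp
  have Xlaw: "distr P borel (X i) = \<mu>" if "i \<in> {1..n}" for i
  proof -
    have "distr P borel (X j) = distr (distr P borel (\<lambda>\<omega>. (X j \<omega>, Y j \<omega>))) borel fst" if "j \<in> {0..n}" for j
      using Wm[OF that] fst_m by (simp add: distr_distr comp_def)
    then show ?thesis using Wlaw[of i] that by (simp add: \<mu>_def)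
  qed
  have Wind: "P.indep_vars (\<lambda>_. borel) (\<lambda>i \<omega>. (X i \<omega>, Y i \<omega>)) {1..n}"
    by (rule P.indep_vars_subset[OF Wall]) simp
  \<comment> \<open>Measurability of \<open>g\<close> is known on \<open>S\<close> only; extension
    by zero gives a Borel function on the whole space.\<close>
  define g' where "g' y = indicator S y *\<^sub>R g y" for y
  have g': "g' \<in> borel_measurable borel"
    using regression S unfolding g'_def regression_function_def
    by (simp add: borel_measurable_restrict_space_iff)
  define e where "e w = snd w - g' (fst w)" for w
  have e: "e \<in> borel_measurable borel"
    unfolding e_def using measurable_compose[OF fst_m g'] snd_m by (intro borel_measurable_diff) auto
  \<comment> \<open>The noise condition concerns the copy with index 0. Both sides depend only on
    the law of the pair, which is common to all indices.\<close>
  have mgf: "(\<integral>\<^sup>+\<omega>. ennreal (exp (t * e (X i \<omega>, Y i \<omega>))) * indicator A (X i \<omega>) \<partial>P)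
      \<le> ennreal (exp (t\<^sup>2 * \<sigma>\<^sup>2 / 2) * P.prob {\<omega> \<in> space P. X i \<omega> \<in> A})"
    if i: "i \<in> {1..n}" and A: "A \<in> sets borel" for i t A
  proof -
    define h where "h w = ennreal (exp (t * e w)) * indicator A (fst w)" for w
    have "(\<lambda>w :: 'a \<times> real. indicator A (fst w) :: ennreal) \<in> borel_measurable borel"
      by (rule measurable_compose[OF fst_m borel_measurable_indicator[OF A]])
    then have h: "h \<in> borel_measurable borel"
      unfolding h_def using e by (intro borel_measurable_times_ennreal) measurable
    have trans: "(\<integral>\<^sup>+\<omega>. h (X j \<omega>, Y j \<omega>) \<partial>P) = (\<integral>\<^sup>+w. h w \<partial>distr P borel (\<lambda>\<omega>. (X j \<omega>, Y j \<omega>)))"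
      if "j \<in> {0..n}" for j
      using nn_integral_distr[OF Wm[OF that] ] h by simp
    have pA: "P.prob {\<omega> \<in> space P. X j \<omega> \<in> A} = measure (distr P borel (X j)) A" if "j \<in> {0..n}" for j
      using Xm[OF that] A by (subst measure_distr) (auto intro!: arg_cong[where f=P.prob])
    have "(\<integral>\<^sup>+\<omega>. h (X i \<omega>, Y i \<omega>) \<partial>P) = (\<integral>\<^sup>+\<omega>. h (X 0 \<omega>, Y 0 \<omega>) \<partial>P)"
      using trans[of i] trans[of 0] Wlaw[of i] i by simp
    also have "\<dots> = (\<integral>\<^sup>+\<omega>. ennreal (exp (t * (Y 0 \<omega> - g (X 0 \<omega>)))) * indicator A (X 0 \<omega>) \<partial>P)"
      using X_in_S by (intro nn_integral_cong) (auto simp: h_def e_def g'_def)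
    also have "\<dots> \<le> ennreal (exp (t\<^sup>2 * \<sigma>\<^sup>2 / 2) * P.prob {\<omega> \<in> space P. X 0 \<omega> \<in> A})"
      by (rule P.cond_subgaussian_mgf[OF subgaussian _ Zm A]) (use Xm in auto)
    also have "P.prob {\<omega> \<in> space P. X 0 \<omega> \<in> A} = P.prob {\<omega> \<in> space P. X i \<omega> \<in> A}"
      using pA[of 0] pA[of i] Xlaw[OF i] i by (simp add: \<mu>_def)
    finally show ?thesis by (simp add: h_def)
  qed
  have mass: "q \<le> measure \<mu> A" if A: "A \<in> sets borel" "S \<inter> cball x (s / 2) \<subseteq> A" for A
  proof -
    \<comment> \<open>The chain \<open>s / 2 \<le> s \<le> r \<le> \<tau> \<le> T0\<close> admits
      the lower mass bound at radius \<open>s / 2\<close>; its link \<open>r \<le> \<tau>\<close>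
      comes from \<open>1 \<le> u\<close>.\<close>
    have "1 * s \<le> 9 * d * s" using d s by (intro mult_right_mono) auto
    then have "s \<le> r" using ds by linarith
    have "r \<le> \<tau>"
      unfolding r_def \<tau>_def using ma u1 by (intro powr_mono2) (auto simp: divide_right_mono)
    have "q \<le> measure \<mu> (ball x (s / 2))"
      unfolding q_def d_def using s \<open>s \<le> r\<close> \<open>r \<le> \<tau>\<close> \<tau>T by (intro \<mu>.lower[OF x]) auto
    also have "\<dots> = measure \<mu> (ball x (s / 2) \<inter> S)"
      using \<mu>.full \<mu>.prob_space by (intro \<mu>.measure_space_inter[symmetric]) (auto simp: \<mu>.sets_mu S)
    also have "\<dots> \<le> measure \<mu> A"
      using A by (intro \<mu>.finite_measure_mono) (auto simp: \<mu>.sets_mu)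
    finally show ?thesis .
  qed

  \<comment> \<open>The three exceptional events\<close>
  obtain B1 where B1: "B1 \<in> sets P"
    "P.prob B1 \<le> (2 * DIM('a)) ^ DIM('a) / (a * \<tau> ^ DIM('a)) * exp (- (card {1..m} * a * \<tau> ^ DIM('a) / 2))"
    "\<And>\<omega> y. \<omega> \<in> space P - B1 \<Longrightarrow> y \<in> S \<Longrightarrow> \<exists>k\<in>{1..m}. dist y (Z k \<omega>) \<le> \<tau>"
    by (rule \<mu>.covering[OF assms(1) Zind Zlaw _ _ \<tau> \<tau>T]) (use nm in auto)
  have p1: "P.prob B1 \<le> \<delta>"
  proof -
    \<comment> \<open>\<open>a * \<tau> ^ d\<close> is \<open>u / m\<close>, so the exponent of the
      covering bound is \<open>- (u / 2)\<close>.\<close>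
    have "P.prob B1 \<le> (2 * real d) ^ d * (m / u) * exp (- (u / 2))"
      using B1(2) a nm u_pos by (simp add: d_def[symmetric] \<tau>d power_mult_distrib)
    also have "\<dots> \<le> \<delta>"
      unfolding u_def by (rule covering_constant) (use d \<delta> nm um in \<open>auto simp: u_def\<close>)
    finally show ?thesis .
  qed
  obtain B2 where B2: "B2 \<in> sets P"
    "P.prob B2 \<le> 4 * card {1..m} * (M * Vd * DIM('a) * s * r ^ (DIM('a) - 1))"
    "\<And>\<omega>. \<omega> \<in> space P - B2 \<Longrightarrow> \<exists>k\<in>{1..m}. dist x (Z k \<omega>) \<le> T0 \<Longrightarrow>
      \<exists>k\<in>{1..m}. \<forall>j\<in>{1..m} - {k}. dist x (Z k \<omega>) + s < dist x (Z j \<omega>)"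
    by (rule \<mu>.spacing[OF assms(1) Zind Zlaw _ _ x, of s r]) (use nm s ds r mar in \<open>auto simp: d_def\<close>)
  have p2: "P.prob B2 \<le> \<delta>"
  proof -
    have "r ^ d = r * r ^ (d - 1)" using d by (cases d) auto
    then have "4 * real m * (M * Vd * d * s * r ^ (d - 1)) = 4 / 9 * \<delta> * (m * a * r ^ d)"
      using M d by (simp add: s_def a_def field_simps)
    also have "\<dots> \<le> \<delta>" unfolding mar using \<delta> by simp
    finally show ?thesis using B2(2) by (simp add: d_def[symmetric])
  qed
  have m1: "m \<ge> 1" using nm by simp
  define V where "V \<omega> = voronoi_cell_at S (\<lambda>k. Z k \<omega>) m x" for \<omega>
  define N where "N \<omega> = (\<Sum>i=1..n. indicator (V \<omega>) (X i \<omega>) :: real)" for \<omega>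
  obtain B3 where B3: "B3 \<in> sets P" "P.prob B3 \<le> 3 * exp (- l)"
    "\<And>\<omega>. \<omega> \<in> space P - B3 \<Longrightarrow> \<exists>k\<in>{1..m}. \<forall>j\<in>{1..m} - {k}. dist x (Z k \<omega>) + s < dist x (Z j \<omega>) \<Longrightarrow>
      real n * q / 2 \<le> N \<omega> \<and>
      \<bar>\<Sum>i=1..n. e (X i \<omega>, Y i \<omega>) * indicator (V \<omega>) (X i \<omega>)\<bar> \<le> sqrt (2 * \<sigma>\<^sup>2 * l * N \<omega>)"
    unfolding N_def V_def
    by (rule cell_tail_joint[OF assms(1) Wind proto_indep_data m1 S e Xlaw mgf mass])
      (use s q l lq in auto)

  \<comment> \<open>The error on the good event\<close>
  define A where "A = space P - (B1 \<union> (B2 \<union> B3))"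
  have A: "A \<in> sets P" using B1 B2 B3 by (auto simp: A_def)
  \<comment> \<open>The budgets are \<delta>, \<delta> and 3 \<delta>, since
    \<open>exp (- l)\<close> is \<delta>.\<close>
  have "P.prob (B1 \<union> (B2 \<union> B3)) \<le> P.prob B1 + (P.prob B2 + P.prob B3)"
    using B1(1) B2(1) B3(1) by (intro order_trans[OF measure_Un_le] add_left_mono measure_Un_le) auto
  moreover have "P.prob A = 1 - P.prob (B1 \<union> (B2 \<union> B3))"
    unfolding A_def using B1(1) B2(1) B3(1) by (intro P.prob_compl) auto
  ultimately have pA: "1 - 5 * \<delta> \<le> P.prob A" using p1 p2 B3(2) l by simp
  have bound: "\<bar>proto_nn S (\<lambda>k. Z k \<omega>) m (\<lambda>i. X i \<omega>) (\<lambda>i. Y i \<omega>) n x - g x\<bar>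
      \<le> sqrt (4 * \<sigma>\<^sup>2 * \<psi> * l / \<delta> ^ d) * sqrt (real m / real n) + 2 * lip_const g (V \<omega>) * \<tau>"
    if \<omega>: "\<omega> \<in> A" for \<omega>
  proof -
    have cover: "\<exists>k\<in>{1..m}. dist y (Z k \<omega>) \<le> \<tau>" if "y \<in> S" for y
      using B1(3)[OF _ that, of \<omega>] \<omega> by (auto simp: A_def)
    \<comment> \<open>Covering supplies the nearby prototype that the spacing event
      presupposes.\<close>
    have "\<exists>k\<in>{1..m}. dist x (Z k \<omega>) \<le> T0" using cover[OF x] \<tau>T by force
    then have gap: "\<exists>k\<in>{1..m}. \<forall>j\<in>{1..m} - {k}. dist x (Z k \<omega>) + s < dist x (Z j \<omega>)"
      using B2(3) \<omega> by (auto simp: A_def)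
    have count: "real n * q / 2 \<le> N \<omega>"
      and noise: "\<bar>\<Sum>i=1..n. e (X i \<omega>, Y i \<omega>) * indicator (V \<omega>) (X i \<omega>)\<bar> \<le> sqrt (2 * \<sigma>\<^sup>2 * l * N \<omega>)"
      using B3(3)[OF _ gap] \<omega> by (auto simp: A_def)
    have nq: "0 < real n * q" using nm q by simp
    then have N: "0 < N \<omega>" using count by linarith
    have VS: "V \<omega> \<subseteq> S" unfolding V_def by (rule voronoi_cell_at_subset)
    have xV: "x \<in> V \<omega>" unfolding V_def by (rule in_voronoi_cell_at[OF x])
    have lip: "(lip_const g (V \<omega>))-lipschitz_on (V \<omega>) g"
      by (rule lip_const_least(1)[OF lipschitz_on_subset[OF lipschitz VS]])
    have bias: "\<bar>g y - g x\<bar> \<le> lip_const g (V \<omega>) * (2 * \<tau>)" if y: "y \<in> V \<omega>" for y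
    proof -
      have "\<bar>g y - g x\<bar> \<le> lip_const g (V \<omega>) * dist y x"
        using lipschitz_onD[OF lip y xV] by (simp add: dist_real_def)
      also have "\<dots> \<le> lip_const g (V \<omega>) * (2 * \<tau>)"
        using dist_voronoi_cell[OF m1 cover x, of y] y lipschitz_on_nonneg[OF lip]
        by (intro mult_left_mono) (auto simp: V_def)
      finally show ?thesis .
    qed
    \<comment> \<open>The cell lies in \<open>S\<close>, where \<open>g'\<close> agrees with
      \<open>g\<close>.\<close>
    have "e (X i \<omega>, Y i \<omega>) * indicator (V \<omega>) (X i \<omega>) = (Y i \<omega> - g (X i \<omega>)) * indicator (V \<omega>) (X i \<omega>)" for i
      using VS by (auto simp: e_def g'_def indicator_def)
    with noise have noise': "\<bar>\<Sum>i=1..n. (Y i \<omega> - g (X i \<omega>)) * indicator (V \<omega>) (X i \<omega>)\<bar> \<le> sqrt (2 * \<sigma>\<^sup>2 * l * N \<omega>)"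
      by simp
    have "\<bar>proto_nn S (\<lambda>k. Z k \<omega>) m (\<lambda>i. X i \<omega>) (\<lambda>i. Y i \<omega>) n x - g x\<bar>
      \<le> sqrt (2 * \<sigma>\<^sup>2 * l * N \<omega>) / N \<omega> + lip_const g (V \<omega>) * (2 * \<tau>)"
      using proto_nn_error[OF N[unfolded N_def V_def] noise'[unfolded V_def]] bias by (simp add: N_def V_def)
    also have "sqrt (2 * \<sigma>\<^sup>2 * l * N \<omega>) / N \<omega> = sqrt (2 * \<sigma>\<^sup>2 * l / N \<omega>)"
      using N by (simp add: real_sqrt_mult real_sqrt_divide real_div_sqrt field_simps)
    \<comment> \<open>Self-normalisation leaves the count in the denominator only, so its lower
      bound suffices; halving \<open>n * q\<close> makes the constant 4.\<close>
    also have "\<dots> \<le> sqrt (2 * \<sigma>\<^sup>2 * l / (real n * q / 2))"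
      using count nq l by (intro real_sqrt_le_mono divide_left_mono) auto
    also have "2 * \<sigma>\<^sup>2 * l / (real n * q / 2) = (4 * \<sigma>\<^sup>2 * \<psi> * l / \<delta> ^ d) * (real m / real n)"
      by (simp add: q_eq field_simps)
    also have "sqrt \<dots> = sqrt (4 * \<sigma>\<^sup>2 * \<psi> * l / \<delta> ^ d) * sqrt (real m / real n)"
      by (rule real_sqrt_mult)
    finally show ?thesis by (simp add: mult_ac)
  qed
  have \<tau>_eq: "\<tau> = (32 * real d * ln (12 * m / \<delta>) / (m * b * c * Vd)) powr (1 / d)"
    by (simp add: \<tau>_def u_def a_def mult_ac)
  show "with_prob_at_least P (1 - 5 * \<delta>) (\<lambda>\<omega>.
    \<bar>proto_nn S (\<lambda>k. Z k \<omega>) m (\<lambda>i. X i \<omega>) (\<lambda>i. Y i \<omega>) n x - g x\<bar>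
      \<le> sqrt (4 * \<sigma>\<^sup>2 * \<psi> * ln (1 / \<delta>) / \<delta> ^ DIM('a)) * sqrt (real m / real n)
        + 2 * lip_const g (voronoi_cell_at S (\<lambda>k. Z k \<omega>) m x)
            * (32 * DIM('a) * ln (12 * m / \<delta>) / (m * b * c * Vd)) powr (1 / DIM('a)))"
    unfolding with_prob_at_least_def l_def[symmetric] d_def[symmetric]
    using A pA bound by (intro bexI[of _ A]) (auto simp: V_def \<tau>_eq)
qed

end
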